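(* Let $G$ be a graph that contains a cycle of length $n\ge 5$ (as a not necessarily induced subgraph), where $n\not\equiv 0 \pmod 4$. Then $G$ is $4$-$\chi_\rho$-critical if and only if one of the following holds: (i) $n=5$ and $G$ is isomorphic to one of the following five graphs on the vertex set $\{1,2,3,4,5\}$, each obtained from the $5$-cycle with edges $12,23,34,45,51$ by adding the indicated set of chords: $\emptyset$; $\{35\}$; $\{35,14\}$; $\{35,13\}$; $\{35,13,24\}$; (ii) $n=6$ and $G$ is (up to isomorphism) one of the four bipartite graphs obtained by adding some (possibly empty) subset of chords to the $6$-cycle; (iii) $n\ge 7$ and $G$ is isomorphic to $C_n$.
   Context: Graphs are finite, simple and undirected, with nonempty vertex set. Distance is shortest-path distance ($\infty$ between different components). For a positive integer $i$, an $i$-packing in $G$ is a set of vertices such that any two distinct vertices in it are at distance greater than $i$. The packing chromatic number $\chi_\rho(G)$ is the smallest integer $k$ such that $V(G)$ can be partitioned into (possibly empty) sets $V_1,\ldots,V_k$ with $V_i$ an $i$-packing for each $i\in\{1,\ldots,k\}$. $G-x$ denotes the graph obtained from $G$ by deleting the vertex $x$. A graph $G$ is $k$-$\chi_\rho$-critical if $\chi_\rho(G)=k$ and $\chi_\rho(G-x)<k$ for every vertex $x$ of $G$. $C_n$ denotes the cycle on $n$ vertices. A chord of a cycle is an edge joining two vertices of the cycle that are not consecutive on it. The four bipartite graphs in (ii) are the $6$-cycle with $0$, $1$, $2$ or $3$ chords added, each chord joining two antipodal vertices of the $6$-cycle (with $3$ chords this is $K_{3,3}$). *)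

theory Defs
  imports "Graph_Theory.Graph_Theory"
begin

text \<open>Shortest-path distance: every arc has cost 1. It is \<open>\<infinity>\<close> between different components,
  because the infimum is then taken over the empty set.\<close>

definition gdist :: "('a, 'b) pre_digraph \<Rightarrow> 'a \<Rightarrow> 'a \<Rightarrow> ereal" where
  "gdist G u v = wf_digraph.\<mu> G (\<lambda>_. 1) u v"

definition packing :: "('a, 'b) pre_digraph \<Rightarrow> nat \<Rightarrow> 'a set \<Rightarrow> bool" where
  "packing G i S \<longleftrightarrow>
     S \<subseteq> verts G \<and> (\<forall>u\<in>S. \<forall>v\<in>S. u \<noteq> v \<longrightarrow> gdist G u v > ereal (real i))"

definition packing_partition :: "('a, 'b) pre_digraph \<Rightarrow> nat \<Rightarrow> (nat \<Rightarrow> 'a set) \<Rightarrow> bool" where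
  "packing_partition G k V \<longleftrightarrow>
     (\<Union>i\<in>{1..k}. V i) = verts G \<and> disjoint_family_on V {1..k} \<and>
     (\<forall>i\<in>{1..k}. packing G i (V i))"

definition packing_chromatic_number :: "('a, 'b) pre_digraph \<Rightarrow> nat" where
  "packing_chromatic_number G = (LEAST k. \<exists>V. packing_partition G k V)"

definition packing_critical :: "nat \<Rightarrow> ('a, 'b) pre_digraph \<Rightarrow> bool" where
  "packing_critical k G \<longleftrightarrow>
     packing_chromatic_number G = k \<and>
     (\<forall>x\<in>verts G. packing_chromatic_number (pre_digraph.del_vert G x) < k)"

text \<open>The library's cycles are closed arc walks that repeat no vertex. In a symmetric graph a
  back-and-forth walk along one edge counts as a cycle of length 2, so this is the usual notion
  only for \<open>n \<ge> 3\<close>.\<close>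

definition has_cycle :: "('a, 'b) pre_digraph \<Rightarrow> nat \<Rightarrow> bool" where
  "has_cycle G n \<longleftrightarrow> (\<exists>p. pre_digraph.cycle G p \<and> length p = n)"

text \<open>The simple graph on \<open>{1..n}\<close> whose edges are those of the \<open>n\<close>-cycle \<open>1, 2, \<dots>, n\<close> (for
  \<open>n \<ge> 3\<close>) and those in \<open>D\<close>. Each edge is listed once, in either orientation; the symmetric
  closure provides both arcs.\<close>

definition cycle_edges :: "nat \<Rightarrow> (nat \<times> nat) set" where
  "cycle_edges n = {(i, i + 1) | i. 1 \<le> i \<and> i < n} \<union> {(n, 1)}"

definition cycle_plus :: "nat \<Rightarrow> (nat \<times> nat) set \<Rightarrow> nat pair_pre_digraph" where
  "cycle_plus n D =
     \<lparr>pverts = {1..n}, parcs = (cycle_edges n \<union> D) \<union> (cycle_edges n \<union> D)\<inverse>\<rparr>"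

abbreviation cycle_graph :: "nat \<Rightarrow> nat pair_pre_digraph" where
  "cycle_graph n \<equiv> cycle_plus n {}"

end

theory Submission
  imports Defs
begin

text \<open>
  Deleting vertices or edges never decreases a distance, so a graph is at least as hard to colour as
  each of its subgraphs. The proof rests on three obstructions to a packing 3-colouring.

  (1) A cycle of length \<open>n \<ge> 5\<close> with \<open>4 \<nmid> n\<close> has none (\<open>cyclic_not_3_colourable\<close>): its
  colours are forced to repeat \<open>1, 2, 1, 3\<close>. Hence such a cycle in a critical graph \<open>G\<close> cannot miss a
  vertex \<open>x\<close>, because \<open>G - x\<close> would still contain it. So \<open>G\<close> is an \<open>n\<close>-cycle plus chords, and no
  chord may cut off a shorter cycle of this kind.

  (2) An edge \<open>uv\<close> whose ends both have degree at least 3 and can each be prolonged by two more vertices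
  also prevents a 3-colouring (\<open>edge_with_two_branches_not_3_colourable\<close>): neither end may have colour 1,
  so the ends have colours 2 and 3, and then the path that leaves the end of colour 2 gets stuck. A chord
  of an \<open>n\<close>-cycle together with its surroundings is such a configuration on at most 8 vertices, so for
  \<open>n \<ge> 9\<close> a vertex remains whose deletion does not help, and \<open>G\<close> has no chord. For \<open>n = 7\<close> each
  chord cuts off a 5-cycle or a 6-cycle, and for \<open>n = 6\<close> a non-antipodal chord cuts off a 5-cycle, so (1)
  applies.

  (3) A complete graph on four vertices needs four colours. For \<open>n = 5\<close> this says that no four
  vertices of \<open>G\<close> are pairwise adjacent, that is, that the missing chords contain two disjoint ones;
  up to rotation these are the five listed graphs.

  Conversely, each listed graph contains the cycle and so is not 3-colourable, and for each vertex
  \<open>x\<close> it has a 4-colouring in which only \<open>x\<close> has colour 4. Such colourings give criticality at once,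
  since restricting one of them colours \<open>G - x\<close> with three colours.
\<close>

section \<open>Packing colourings\<close>

text \<open>
  Distances enter only through the question whether they are at most a given number, and hence through
  walks of bounded length. Stating this for an arbitrary relation on an arbitrary vertex set makes
  subgraphs and deleted vertices easy to treat. The bound \<open>j = 0\<close> is harmless, as \<open>u \<noteq> v\<close>.
\<close>

definition packing_colouring :: "'a rel \<Rightarrow> 'a set \<Rightarrow> nat \<Rightarrow> ('a \<Rightarrow> nat) \<Rightarrow> bool" where
  "packing_colouring E V k f \<longleftrightarrow>
     (\<forall>v\<in>V. f v \<in> {1..k}) \<and>
     (\<forall>u\<in>V. \<forall>v\<in>V. u \<noteq> v \<and> f u = f v \<longrightarrow> (\<forall>j\<le>f u. (u, v) \<notin> E ^^ j))"

lemma (in wf_digraph) awalk_imp_relpow: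
  "awalk u p v \<Longrightarrow> (u, v) \<in> arcs_ends G ^^ length p"
proof (induction p arbitrary: u)
  case (Cons e p)
  then have "(u, head G e) \<in> arcs_ends G" "awalk (head G e) p v"
    by (auto simp: awalk_Cons_iff intro: in_arcs_imp_in_arcs_ends)
  then show ?case using Cons.IH by (simp only: list.size add_0_right add_Suc_right) (rule relpow_Suc_I2)
qed (simp add: awalk_Nil_iff)

lemma (in wf_digraph) relpow_imp_awalk:
  "(u, v) \<in> arcs_ends G ^^ j \<Longrightarrow> u \<in> verts G \<Longrightarrow> \<exists>p. awalk u p v \<and> length p = j"
proof (induction j arbitrary: u)
  case (Suc j)
  then obtain w where w: "(u, w) \<in> arcs_ends G" "(w, v) \<in> arcs_ends G ^^ j"
    by (meson relpow_Suc_D2)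
  then obtain e where e: "e \<in> arcs G" "tail G e = u" "head G e = w"
    by (auto simp: arcs_ends_conv)
  with Suc.IH[OF w(2)] obtain p where "awalk w p v" "length p = j" by auto
  with e show ?case by (intro exI[of _ "e # p"]) (auto simp: awalk_Cons_iff)
qed (auto simp: awalk_Nil_iff)

text \<open>
  All arcs have cost 1, so the costs of walks are natural numbers; if no walk has length at most \<open>i\<close>,
  the infimum is therefore at least \<open>i + 1\<close>.
\<close>

lemma (in wf_digraph) gdist_le_iff:
  assumes "u \<in> verts G"
  shows "gdist G u v \<le> ereal (real i) \<longleftrightarrow> (\<exists>j\<le>i. (u, v) \<in> arcs_ends G ^^ j)"
proof
  assume "\<exists>j\<le>i. (u, v) \<in> arcs_ends G ^^ j"
  then obtain p where "awalk u p v" "length p \<le> i"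
    using relpow_imp_awalk assms by blast
  moreover have "awalk_cost (\<lambda>_. 1) p = real (length p)"
    by (simp add: awalk_cost_def sum_list_triv)
  ultimately show "gdist G u v \<le> ereal (real i)"
    using min_cost_le_walk_cost[of u p v "\<lambda>_. 1"] unfolding gdist_def
    by (metis ereal_less_eq(3) of_nat_le_iff order_trans)
next
  assume le: "gdist G u v \<le> ereal (real i)"
  show "\<exists>j\<le>i. (u, v) \<in> arcs_ends G ^^ j"
  proof (rule ccontr)
    assume none: "\<not> ?thesis"
    have "ereal (real (i + 1)) \<le> \<mu> (\<lambda>_. 1) u v"
      unfolding \<mu>_def
    proof (rule INF_greatest)
      fix p assume "p \<in> {p. awalk u p v}"
      then have "i < length p" using none awalk_imp_relpow by (auto simp: not_le[symmetric])
      then show "ereal (real (i + 1)) \<le> ereal (awalk_cost (\<lambda>_. 1) p)"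
        by (simp add: awalk_cost_def sum_list_triv)
    qed
    from order_trans[OF this le[unfolded gdist_def]] show False by simp
  qed
qed

lemma (in wf_digraph) packing_partition_iff_colouring:
  "(\<exists>P. packing_partition G k P) \<longleftrightarrow> (\<exists>f. packing_colouring (arcs_ends G) (verts G) k f)"
proof
  assume "\<exists>P. packing_partition G k P"
  then obtain P where cover: "(\<Union>i\<in>{1..k}. P i) = verts G"
    and pack: "\<And>i. i \<in> {1..k} \<Longrightarrow> packing G i (P i)"
    unfolding packing_partition_def by blast
  define f where "f v = (SOME i. i \<in> {1..k} \<and> v \<in> P i)" for v
  have f: "f v \<in> {1..k} \<and> v \<in> P (f v)" if "v \<in> verts G" for v
    unfolding f_def by (rule someI_ex) (use that cover in blast)
  have "(u, v) \<notin> arcs_ends G ^^ j"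
    if "u \<in> verts G" "v \<in> verts G" "u \<noteq> v" "f u = f v" "j \<le> f u" for u v j
  proof -
    have "gdist G u v > ereal (real (f u))"
      using pack[of "f u"] f[OF that(1)] f[OF that(2)] that unfolding packing_def by auto
    then show ?thesis using gdist_le_iff[OF that(1)] that(5) by (meson not_le)
  qed
  then show "\<exists>f. packing_colouring (arcs_ends G) (verts G) k f"
    unfolding packing_colouring_def using f by blast
next
  assume "\<exists>f. packing_colouring (arcs_ends G) (verts G) k f"
  then obtain f where f: "packing_colouring (arcs_ends G) (verts G) k f" ..
  have "packing G i {v \<in> verts G. f v = i}" for i
    unfolding packing_def
  proof (intro conjI ballI impI)
    fix u v assume "u \<in> {v \<in> verts G. f v = i}" "v \<in> {v \<in> verts G. f v = i}" "u \<noteq> v"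
    then show "ereal (real i) < gdist G u v"
      using f gdist_le_iff[of u v i] unfolding packing_colouring_def by (auto simp: not_le[symmetric])
  qed auto
  then have "packing_partition G k (\<lambda>i. {v \<in> verts G. f v = i})"
    using f unfolding packing_partition_def packing_colouring_def disjoint_family_on_def by auto
  then show "\<exists>P. packing_partition G k P" by blast
qed

lemma packing_colouring_mono:
  "packing_colouring E V k f \<Longrightarrow> k \<le> l \<Longrightarrow> packing_colouring E V l f"
  unfolding packing_colouring_def by force

text \<open>
  A walk of the smaller graph is a walk of the larger one, so distances can only grow. The number of
  colours may shrink at the same time, which is how a colour used on deleted vertices only is dropped.
\<close>

lemma packing_colouring_subset:
  assumes "packing_colouring E V k f" "E' \<subseteq> E" "V' \<subseteq> V" "\<And>v. v \<in> V' \<Longrightarrow> f v \<in> {1..l}"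
  shows "packing_colouring E' V' l f"
proof -
  have "E' ^^ j \<subseteq> E ^^ j" for j
    by (induction j) (use assms(2) in auto)
  then show ?thesis using assms(1,3,4) unfolding packing_colouring_def by blast
qed

text \<open>
  Without this the least number of colours would be an unspecified value that says nothing about colourings.
\<close>

lemma injective_packing_colouring:
  assumes "finite V" shows "\<exists>k f. packing_colouring E V k f"
proof -
  obtain h where h: "bij_betw h V {0..<card V}" using ex_bij_betw_finite_nat[OF assms] ..
  have "h v < card V" if "v \<in> V" for v
    using bij_betwE[OF h] that by auto
  moreover have "h u \<noteq> h v" if "u \<in> V" "v \<in> V" "u \<noteq> v" for u v
    using h that by (auto simp: bij_betw_def inj_on_def)
  ultimately have "packing_colouring E V (card V) (\<lambda>v. h v + 1)"
    unfolding packing_colouring_def by (fastforce simp: Suc_le_eq)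
  then show ?thesis by blast
qed

lemma (in fin_digraph) packing_chromatic_number_le_iff:
  "packing_chromatic_number G \<le> k \<longleftrightarrow> (\<exists>f. packing_colouring (arcs_ends G) (verts G) k f)"
proof
  assume "packing_chromatic_number G \<le> k"
  moreover have "\<exists>k. \<exists>P. packing_partition G k P"
    using injective_packing_colouring[OF finite_verts] packing_partition_iff_colouring by metis
  then have "\<exists>P. packing_partition G (packing_chromatic_number G) P"
    unfolding packing_chromatic_number_def by (rule LeastI_ex)
  ultimately show "\<exists>f. packing_colouring (arcs_ends G) (verts G) k f"
    using packing_colouring_mono packing_partition_iff_colouring by metis
next
  assume "\<exists>f. packing_colouring (arcs_ends G) (verts G) k f"
  then show "packing_chromatic_number G \<le> k"
    unfolding packing_chromatic_number_def packing_partition_iff_colouring[symmetric]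
    by (rule Least_le)
qed

lemma deleted_ends:
  assumes "pair_wf_digraph G"
  shows "arcs_ends (pre_digraph.del_vert (with_proj G) x) = Restr (parcs G) (pverts G - {x})"
proof -
  interpret pair_wf_digraph G by fact
  show ?thesis by (auto simp: arcs_ends_conv del_vert_simps dest: in_arcsD1 in_arcsD2)
qed

lemma critical_imp_deleted_colourable:
  assumes "pair_graph G" "packing_critical 4 (with_proj G)" "x \<in> pverts G"
  shows "\<exists>f. packing_colouring (Restr (parcs G) (pverts G - {x})) (pverts G - {x}) 3 f"
proof -
  interpret pair_graph G by fact
  interpret D: fin_digraph "del_vert x" by (rule fin_digraph_del_vert)
  have "packing_chromatic_number (del_vert x) \<le> 3"
    using assms(2,3) unfolding packing_critical_def by fastforce
  then show ?thesis
    unfolding D.packing_chromatic_number_le_iff deleted_ends[OF pair_wf_digraph]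
    by (simp add: del_vert_simps)
qed

text \<open>
  One family of colourings serves both halves of criticality: the colouring in which \<open>x\<close> alone has colour 4
  bounds the packing chromatic number of \<open>G\<close>, and its restriction to \<open>G - x\<close> needs three colours only.
\<close>

lemma colourings_imp_critical:
  assumes "pair_graph G" "pverts G \<noteq> {}"
    and "\<And>f. \<not> packing_colouring (parcs G) (pverts G) 3 f"
    and "\<And>x. x \<in> pverts G \<Longrightarrow> \<exists>f. packing_colouring (parcs G) (pverts G) 4 f \<and>
           (\<forall>v\<in>pverts G. f v = 4 \<longrightarrow> v = x)"
  shows "packing_critical 4 (with_proj G)"
  unfolding packing_critical_def
proof (intro conjI ballI)
  interpret pair_graph G by fact
  have le: "packing_chromatic_number (with_proj G) \<le> k \<longleftrightarrow>
      (\<exists>f. packing_colouring (parcs G) (pverts G) k f)" for k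
    using packing_chromatic_number_le_iff by simp
  obtain x where "x \<in> pverts G" using assms(2) by blast
  then have "packing_chromatic_number (with_proj G) \<le> 4" unfolding le using assms(4) by blast
  moreover have "\<not> packing_chromatic_number (with_proj G) \<le> 3" unfolding le using assms(3) by blast
  ultimately show "packing_chromatic_number (with_proj G) = 4" by simp
next
  interpret pair_graph G by fact
  fix x assume "x \<in> verts (with_proj G)"
  interpret D: fin_digraph "del_vert x" by (rule fin_digraph_del_vert)
  obtain f where f: "packing_colouring (parcs G) (pverts G) 4 f" "\<forall>v\<in>pverts G. f v = 4 \<longrightarrow> v = x"
    using assms(4) \<open>x \<in> _\<close> by auto
  have "f v \<in> {1..3}" if "v \<in> pverts G - {x}" for v
    using f that unfolding packing_colouring_def by (force simp: le_less_Suc_eq)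
  then have "packing_colouring (Restr (parcs G) (pverts G - {x})) (pverts G - {x}) 3 f"
    by (intro packing_colouring_subset[OF f(1)]) auto
  then have "packing_chromatic_number (del_vert x) \<le> 3"
    unfolding D.packing_chromatic_number_le_iff deleted_ends[OF pair_wf_digraph]
    by (auto simp: del_vert_simps)
  then show "packing_chromatic_number (pre_digraph.del_vert (with_proj G) x) < 4" by simp
qed

section \<open>Local obstructions to three colours\<close>

lemma packing_colouring_range:
  "packing_colouring E V k f \<Longrightarrow> v \<in> V \<Longrightarrow> 1 \<le> f v \<and> f v \<le> k"
  unfolding packing_colouring_def by auto

lemma packing_colouring_adjacent:
  assumes "packing_colouring E V k f" "u \<in> V" "v \<in> V" "u \<noteq> v" "(u, v) \<in> E"
  shows "f u \<noteq> f v"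
proof
  assume "f u = f v"
  moreover have "1 \<le> f u" using assms by (auto dest: packing_colouring_range)
  ultimately have "(u, v) \<notin> E ^^ 1" using assms unfolding packing_colouring_def by blast
  then show False using assms by simp
qed

lemma packing_colouring_dist2:
  assumes "packing_colouring E V k f" "u \<in> V" "v \<in> V" "u \<noteq> v" "(u, w) \<in> E" "(w, v) \<in> E"
    and "f u \<noteq> 1"
  shows "f u \<noteq> f v"
proof
  assume "f u = f v"
  moreover have "2 \<le> f u" using assms packing_colouring_range[OF assms(1,2)] by auto
  ultimately have "(u, v) \<notin> E ^^ 2" using assms(1-4) unfolding packing_colouring_def by blast
  then show False using assms by (auto simp: numeral_2_eq_2)
qed

lemma packing_colouring_dist3:
  assumes "packing_colouring E V k f" "u \<in> V" "v \<in> V" "u \<noteq> v"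
    and "(u, w) \<in> E" "(w, w') \<in> E" "(w', v) \<in> E" and "3 \<le> f u"
  shows "f u \<noteq> f v"
proof
  assume "f u = f v"
  then have "(u, v) \<notin> E ^^ 3" using assms(1-4,8) unfolding packing_colouring_def by blast
  then show False using assms by (auto simp: numeral_3_eq_3)
qed

text \<open>
  Three neighbours of a vertex of colour 1 would have to share the colours 2 and 3, but any two of them
  are at distance at most 2.
\<close>

lemma degree_three_colour_ne_1:
  assumes f: "packing_colouring E V 3 f" and "sym E"
    and "{u, a, b, v} \<subseteq> V" "distinct [u, a, b, v]"
    and "(u, a) \<in> E" "(u, b) \<in> E" "(u, v) \<in> E"
  shows "f u \<noteq> 1"
proof
  assume 1: "f u = 1"
  have rev: "(a, u) \<in> E" "(b, u) \<in> E" "(v, u) \<in> E" using assms by (auto dest: symD)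
  have "f a \<noteq> 1" "f b \<noteq> 1" "f v \<noteq> 1"
    using packing_colouring_adjacent[OF f, of u] 1 assms by fastforce+
  moreover have "f a \<noteq> f b" "f a \<noteq> f v" "f b \<noteq> f v"
    using packing_colouring_dist2[OF f, of _ _ u] calculation rev assms by auto
  moreover have "f a \<le> 3" "f b \<le> 3" "f v \<le> 3" "1 \<le> f a" "1 \<le> f b" "1 \<le> f v"
    using packing_colouring_range[OF f] assms by auto
  ultimately show False by linarith
qed

text \<open>
  Both colours of the edge are still forbidden at \<open>a\<close>, which therefore has colour 1. Then \<open>b\<close> cannot have
  colour 1 (next to \<open>a\<close>), colour 2 (at distance 2 from \<open>v\<close>) or colour 3 (at distance 3 from \<open>u\<close>).
\<close>

lemma path_from_edge_coloured_3_2: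
  assumes f: "packing_colouring E V 3 f"
    and "{u, v, a, b} \<subseteq> V" "distinct [u, v, a, b]"
    and "(u, v) \<in> E" "(v, a) \<in> E" "(a, b) \<in> E" and "f u = 3" "f v = 2"
  shows False
proof -
  have "f a \<noteq> 2" "f a \<noteq> 3"
    using packing_colouring_adjacent[OF f, of v a] packing_colouring_dist2[OF f, of u a v] assms by auto
  then have "f a = 1" using packing_colouring_range[OF f, of a] assms by auto
  moreover have "f b \<noteq> 3" using packing_colouring_dist3[OF f, of u b v a] assms by auto
  moreover have "f b \<noteq> 2" using packing_colouring_dist2[OF f, of v b a] assms by auto
  moreover have "f a \<noteq> f b" using packing_colouring_adjacent[OF f, of a b] assms by auto
  ultimately show False using packing_colouring_range[OF f, of b] assms by auto
qed

text \<open>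
  The ends of the edge have colours 2 and 3 in some order, because both have degree at least 3. The
  path leaves from whichever end has colour 2, so one is required at each end. Vertices on
  different sides may coincide: this happens for short cycles through the edge.
\<close>

lemma edge_with_two_branches_not_3_colourable:
  assumes f: "packing_colouring E V 3 f" and sym: "sym E"
    and "{u, v, a, b, b2, a', b', b2'} \<subseteq> V"
    and "distinct [u, v, a, b]" "distinct [u, v, b, b2]"
    and "distinct [v, u, a', b']" "distinct [v, u, b', b2']"
    and "(u, v) \<in> E" "(u, a) \<in> E" "(u, b) \<in> E" "(b, b2) \<in> E"
    and "(v, a') \<in> E" "(v, b') \<in> E" "(b', b2') \<in> E"
  shows False
proof -
  have vu: "(v, u) \<in> E" using sym assms by (auto dest: symD)
  have "f u \<noteq> 1" using degree_three_colour_ne_1[OF f sym, of u a b v] assms by auto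
  moreover have "f v \<noteq> 1" using degree_three_colour_ne_1[OF f sym, of v a' b' u] assms vu by auto
  moreover have "f u \<noteq> f v" using packing_colouring_adjacent[OF f, of u v] assms by auto
  ultimately consider "f u = 3" "f v = 2" | "f u = 2" "f v = 3"
    using packing_colouring_range[OF f, of u] packing_colouring_range[OF f, of v] assms by force
  then show False
  proof cases
    case 1 then show ?thesis using path_from_edge_coloured_3_2[OF f, of u v b' b2'] assms by auto
  next
    case 2 then show ?thesis using path_from_edge_coloured_3_2[OF f, of v u b b2] assms vu by auto
  qed
qed

lemma K4_not_3_colourable:
  assumes f: "packing_colouring E V 3 f" and "{a, b, c, d} \<subseteq> V" "distinct [a, b, c, d]"
    and "(a, b) \<in> E" "(a, c) \<in> E" "(a, d) \<in> E" "(b, c) \<in> E" "(b, d) \<in> E" "(c, d) \<in> E"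
  shows False
proof -
  have "f a \<noteq> f b" "f a \<noteq> f c" "f a \<noteq> f d" "f b \<noteq> f c" "f b \<noteq> f d" "f c \<noteq> f d"
    using packing_colouring_adjacent[OF f] assms by auto
  moreover have "1 \<le> f v \<and> f v \<le> 3" if "v \<in> {a, b, c, d}" for v
    using packing_colouring_range[OF f] assms that by auto
  ultimately show False by (smt (verit) insertCI le_antisym not_less_eq_eq numeral_3_eq_3 One_nat_def)
qed

section \<open>Cyclic enumerations\<close>

text \<open>
  A cycle is traversed by all integers, with period \<open>n\<close>. In this way rotating the cycle and going
  past its starting point are ordinary additions.
\<close>

definition cyclic_enum :: "'a rel \<Rightarrow> nat \<Rightarrow> (int \<Rightarrow> 'a) \<Rightarrow> bool" where
  "cyclic_enum E n c \<longleftrightarrow> (\<forall>i. (c i, c (i + 1)) \<in> E) \<and>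
     (\<forall>i j. c i = c j \<longleftrightarrow> i mod int n = j mod int n)"

lemma cyclic_enum_edge: "cyclic_enum E n c \<Longrightarrow> (c i, c (i + 1)) \<in> E"
  and cyclic_enum_eq_iff: "cyclic_enum E n c \<Longrightarrow> c i = c j \<longleftrightarrow> i mod int n = j mod int n"
  unfolding cyclic_enum_def by auto

lemma cyclic_enum_period: "cyclic_enum E n c \<Longrightarrow> c (i + int n) = c i"
  by (simp add: cyclic_enum_eq_iff)

lemma cyclic_enum_shift: "cyclic_enum E n c \<Longrightarrow> c i = c j \<Longrightarrow> c (i + s) = c (j + s)"
  by (simp add: cyclic_enum_eq_iff mod_eq_dvd_iff)

lemma cyclic_enum_inj:
  assumes "cyclic_enum E n c" "\<bar>i - j\<bar> < int n" "c i = c j"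
  shows "i = j"
proof -
  have "int n dvd i - j" using assms by (simp add: cyclic_enum_eq_iff mod_eq_dvd_iff)
  then show ?thesis using assms(2) by (metis dvd_abs_iff eq_iff_diff_eq_0 abs_ge_zero abs_0_eq zdvd_not_zless order_less_le)
qed

lemma cyclic_enum_rotate: "cyclic_enum E n c \<Longrightarrow> cyclic_enum E n (\<lambda>i. c (i + s))"
  unfolding cyclic_enum_def
  by (intro conjI allI) (metis add.assoc add.commute, simp add: mod_eq_dvd_iff)

lemma range_rotate: "range (\<lambda>i::int. c (i + s)) = range c"
proof -
  have "c i = c ((i - s) + s)" for i by simp
  then show ?thesis by (metis (no_types, lifting) image_eqI rangeI subset_antisym image_subsetI)
qed

lemma cyclic_enum_mod: "cyclic_enum E n c \<Longrightarrow> c (i mod int n) = c i"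
  by (simp add: cyclic_enum_eq_iff)

lemma cyclic_enum_range:
  assumes "cyclic_enum E n c" "n > 0"
  shows "range c = c ` {s..<s + int n}"
proof -
  have "c i = c (s + (i - s) mod int n)" for i
    using assms by (simp add: cyclic_enum_eq_iff mod_add_right_eq)
  moreover have "s + (i - s) mod int n \<in> {s..<s + int n}" for i using assms by auto
  ultimately show ?thesis by blast
qed

lemma cyclic_enum_of_list:
  assumes "m > 0" "inj_on d {..<m}" "\<And>i. i + 1 < m \<Longrightarrow> (d i, d (i + 1)) \<in> E"
    and "(d (m - 1), d 0) \<in> E"
  shows "cyclic_enum E m (\<lambda>i. d (nat (i mod int m)))"
  unfolding cyclic_enum_def
proof (intro conjI allI)
  fix i :: int
  define r where "r = nat (i mod int m)"
  have r: "int r = i mod int m" "r < m" using assms(1) by (auto simp: r_def nat_less_iff)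
  have "(i + 1) mod int m = (int r + 1) mod int m" using r by (simp add: mod_add_left_eq)
  then have succ: "nat ((i + 1) mod int m) = (if r + 1 < m then r + 1 else 0)"
  proof (cases "r + 1 < m")
    case False
    then have "int r + 1 = int m" using r by linarith
    then show ?thesis using \<open>(i + 1) mod int m = _\<close> False by simp
  qed (use \<open>(i + 1) mod int m = _\<close> in \<open>simp add: nat_eq_iff\<close>)
  then show "(d (nat (i mod int m)), d (nat ((i + 1) mod int m))) \<in> E"
    using assms(3,4) r unfolding r_def[symmetric]
  proof (cases "r + 1 < m")
    case False
    then have "r = m - 1" using r by linarith
    then show "(d r, d (nat ((i + 1) mod int m))) \<in> E" using assms(4) False succ by simp
  qed simp
next
  fix i j :: int
  have "nat (i mod int m) < m" "nat (j mod int m) < m"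
    using assms(1) by (auto simp: nat_less_iff)
  then show "d (nat (i mod int m)) = d (nat (j mod int m)) \<longleftrightarrow> i mod int m = j mod int m"
    using assms(1) inj_onD[OF assms(2), of "nat (i mod int m)" "nat (j mod int m)"]
    by (auto simp: eq_nat_nat_iff)
qed

text \<open>
  By the argument of \<open>path_from_edge_coloured_3_2\<close>, colours 2 and 3 are never adjacent, so every second
  vertex has colour 1. The others alternate between 2 and 3, since two vertices of colour 2 are not at
  distance 2, and likewise for 3. So the vertices of colour 2 recur exactly every four steps, and \<open>4\<close>
  divides \<open>n\<close>. The bound on \<open>n\<close> keeps vertices up to three steps apart distinct.
\<close>

lemma cyclic_not_3_colourable:
  assumes c: "cyclic_enum E n c" and "n \<ge> 5" "n mod 4 \<noteq> 0" and V: "range c \<subseteq> V"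
  shows "\<not> packing_colouring E V 3 f"
proof
  assume f: "packing_colouring E V 3 f"
  define g where "g i = f (c i)" for i
  have in_V: "c i \<in> V" for i using V by auto
  have e: "(c i, c (i + 1)) \<in> E" "(c (i + 1), c (i + 2)) \<in> E" "(c (i + 2), c (i + 3)) \<in> E" for i
    using cyclic_enum_edge[OF c, of i] cyclic_enum_edge[OF c, of "i + 1"]
      cyclic_enum_edge[OF c, of "i + 2"] by (simp_all add: add.assoc)
  have ne: "c i \<noteq> c (i + 1)" "c i \<noteq> c (i + 2)" "c i \<noteq> c (i + 3)" for i
    using cyclic_enum_inj[OF c, of i "i + 1"] cyclic_enum_inj[OF c, of i "i + 2"]
      cyclic_enum_inj[OF c, of i "i + 3"] assms(2) by auto
  have rng: "g i = 1 \<or> g i = 2 \<or> g i = 3" for i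
    using packing_colouring_range[OF f in_V[of i]] unfolding g_def by linarith
  have d1: "g i \<noteq> g (i + 1)" for i
    unfolding g_def using packing_colouring_adjacent[OF f in_V in_V ne(1) e(1)] .
  have d2: "g i \<noteq> 1 \<Longrightarrow> g i \<noteq> g (i + 2)" for i
    unfolding g_def using packing_colouring_dist2[OF f in_V in_V ne(2) e(1,2)] .
  have d3: "g i = 3 \<Longrightarrow> g (i + 3) \<noteq> 3" for i
    unfolding g_def using packing_colouring_dist3[OF f in_V in_V ne(3) e(1,2,3), of i] by auto
  have shift: "i + 1 + 1 = i + 2" "i + 2 + 1 = i + 3" "i + 1 + 2 = i + 3" "i + 3 + 1 = i + 4"
    "i + 2 + 2 = i + 4" for i :: int by simp_all
  have "\<not> (g i = 3 \<and> g (i + 1) = 2)" for i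
    using d1[of "i + 1"] d2[of i] d2[of "i + 1"] d1[of "i + 2"] d3[of i] rng[of "i + 2"] rng[of "i + 3"]
    unfolding shift by auto
  \<comment> \<open>The mirror image of the previous step, with the path running backwards from the edge.\<close>
  moreover have "\<not> (g (i + 2) = 2 \<and> g (i + 3) = 3)" for i
    using d1[of "i + 1"] d2[of "i + 1"] d1[of i] d2[of i] d3[of i] rng[of "i + 1"] rng[of i]
    unfolding shift by auto
  then have "\<not> (g i = 2 \<and> g (i + 1) = 3)" for i
    by (metis shift(2) diff_add_cancel)
  ultimately have alt: "g (i + 1) = 1 \<longleftrightarrow> g i \<noteq> 1" for i
    using rng[of i] rng[of "i + 1"] d1[of i] by metis
  have four: "g (i + 1) = 1 \<and> g (i + 2) = 3 \<and> g (i + 3) = 1 \<and> g (i + 4) = 2" if "g i = 2" for i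
    using that alt[of i] alt[of "i + 1"] alt[of "i + 2"] alt[of "i + 3"] d2[of i] d2[of "i + 2"]
      rng[of "i + 2"] rng[of "i + 4"] unfolding shift by auto
  obtain j where "g j \<noteq> 1" using alt[of 0] by blast
  then have "g j = 2 \<or> g (j + 2) = 2"
    using alt[of j] alt[of "j + 1"] d2[of j] rng[of j] rng[of "j + 2"] unfolding shift by auto
  then obtain i where i: "g i = 2" by blast
  have k: "g (i + 4 * int k) = 2" for k
  proof (induction k)
    case (Suc k) then show ?case using four[of "i + 4 * int k"] by (simp add: algebra_simps)
  qed (use i in simp)
  \<comment> \<open>After \<open>n\<close> steps the colour 2 returns, although the position is \<open>n mod 4\<close> steps past a forced 2.\<close>
  have "g (i + int n) = 2" using i cyclic_enum_period[OF c] unfolding g_def by simp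
  moreover have "i + int n = i + 4 * int (n div 4) + int (n mod 4)" by presburger
  moreover have "n mod 4 = 1 \<or> n mod 4 = 2 \<or> n mod 4 = 3" using assms(3) by presburger
  ultimately show False using four[OF k, of "n div 4"] by fastforce
qed

text \<open>
  The chord replaces the path \<open>c i, c (i + 1), \<dots>, c (i + k)\<close>. Recording that the shorter cycle misses
  \<open>c (i + 1)\<close> makes it survive the deletion of that vertex.
\<close>

lemma chord_shortcut:
  assumes c: "cyclic_enum E n c" and chord: "(c i, c (i + int k)) \<in> E" and k: "2 \<le> k" "k < n"
  shows "\<exists>c'. cyclic_enum (Restr E (range c - {c (i + 1)})) (n - k + 1) c' \<and>
    range c' \<subseteq> range c - {c (i + 1)}"
proof -
  define m where "m = n - k + 1"
  \<comment> \<open>The cycle \<open>c i, c (i + k), c (i + k + 1), \<dots>, c (i + n - 1)\<close>.\<close>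
  define d where "d t = (if t = 0 then c i else c (i + int k + int t - 1))" for t
  let ?W = "range c - {c (i + 1)}"
  have d_c: "\<exists>s. d t = c (i + int s) \<and> s < n \<and> s \<noteq> 1 \<and> (if t = 0 then s = 0 else s = k + t - 1)"
    if "t < m" for t
    using that k by (intro exI[of _ "if t = 0 then 0 else k + t - 1"]) (auto simp: d_def m_def of_nat_diff algebra_simps)
  have eq: "s = s'" if "c (i + int s) = c (i + int s')" "s < n" "s' < n" for s s'
    using cyclic_enum_inj[OF c _ that(1)] that(2,3) by auto
  have W: "d t \<in> ?W" if t: "t < m" for t
  proof -
    obtain s where "d t = c (i + int s)" "s < n" "s \<noteq> 1" using d_c[OF t] by blast
    then show ?thesis using eq[of s 1] k by auto
  qed
  have "inj_on d {..<m}"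
  proof (rule inj_onI)
    fix t t' assume t: "t \<in> {..<m}" "t' \<in> {..<m}" "d t = d t'"
    obtain s where s: "d t = c (i + int s)" "s < n" "if t = 0 then s = 0 else s = k + t - 1"
      using d_c[of t] t by blast
    obtain s' where s': "d t' = c (i + int s')" "s' < n" "if t' = 0 then s' = 0 else s' = k + t' - 1"
      using d_c[of t'] t by blast
    have "s = s'" using eq[of s s'] s s' t by auto
    then show "t = t'" using s(3) s'(3) k by (auto split: if_splits)
  qed
  moreover have "(d t, d (t + 1)) \<in> Restr E ?W" if "t + 1 < m" for t
  proof -
    have "(d t, d (t + 1)) \<in> E"
      using chord cyclic_enum_edge[OF c, of "i + int k + int t - 1"] by (auto simp: d_def algebra_simps)
    then show ?thesis using W[of t] W[of "t + 1"] that by auto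
  qed
  moreover have "(d (m - 1), d 0) \<in> Restr E ?W"
  proof -
    have "d (m - 1) = c (i + int n - 1)" using k by (auto simp: d_def m_def of_nat_diff algebra_simps)
    then have "(d (m - 1), d 0) \<in> E"
      using cyclic_enum_edge[OF c, of "i + int n - 1"] cyclic_enum_period[OF c, of i] by (simp add: d_def)
    then show ?thesis using W[of "m - 1"] W[of 0] by (auto simp: m_def)
  qed
  ultimately have "cyclic_enum (Restr E ?W) m (\<lambda>i. d (nat (i mod int m)))"
    by (intro cyclic_enum_of_list) (auto simp: m_def)
  moreover have "range (\<lambda>i. d (nat (i mod int m))) \<subseteq> ?W"
    using W by (auto simp: nat_less_iff m_def simp del: of_nat_add)
  ultimately show ?thesis unfolding m_def by blast
qed

lemma has_cycle_imp_cyclic_enum: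
  assumes "has_cycle (with_proj G) n"
  shows "\<exists>c. cyclic_enum (parcs G) n c"
proof -
  obtain u p where p: "pre_digraph.awalk (with_proj G) u p u"
    "distinct (tl (pre_digraph.awalk_verts (with_proj G) u p))" "p \<noteq> []" "length p = n"
    using assms unfolding has_cycle_def pre_digraph.cycle_def by blast
  have cas: "pcas u p u" and arcs: "set p \<subseteq> parcs G"
    using p(1) by (auto simp: pre_digraph.awalk_def cas_with_proj_eq)
  have verts: "pcas a q b \<Longrightarrow> pawalk_verts a q = a # map snd q" for a b q
    by (induction q arbitrary: a) auto
  have consecutive: "pcas a q b \<Longrightarrow> i + 1 < length q \<Longrightarrow> snd (q ! i) = fst (q ! (i + 1))" for a b q i
  proof (induction q arbitrary: a i)
    case (Cons e q) then show ?case by (cases q; cases i) auto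
  qed simp
  have first: "pcas a q b \<Longrightarrow> q \<noteq> [] \<Longrightarrow> fst (q ! 0) = a \<and> snd (q ! (length q - 1)) = b" for a b q
    by (induction q arbitrary: a) (auto simp: nth_Cons')
  \<comment> \<open>Heads rather than tails: the definition of a cycle states the distinctness of \<open>tl\<close> of the vertex list.\<close>
  define d where "d i = snd (p ! i)" for i
  have arc: "(fst (p ! i), d i) \<in> parcs G" if "i < n" for i
    using arcs that p(4) by (auto simp: d_def)
  have "distinct (map snd p)" using p(2) verts[OF cas] by (simp add: awalk_verts_with_proj_eq)
  then have "inj_on d {..<n}" using p(4) by (auto simp: d_def inj_on_def distinct_conv_nth)
  moreover have "(d i, d (i + 1)) \<in> parcs G" if "i + 1 < n" for i
    using arc[OF that] consecutive[OF cas, of i] that p(4) by (simp add: d_def)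
  moreover have "(d (n - 1), d 0) \<in> parcs G"
    using arc[of 0] first[OF cas p(3)] p(3,4) by (auto simp: d_def)
  ultimately have "cyclic_enum (parcs G) n (\<lambda>i. d (nat (i mod int n)))"
    using p(3,4) by (intro cyclic_enum_of_list) auto
  then show ?thesis by blast
qed

section \<open>Isomorphism with a cycle plus chords\<close>

text \<open>
  The inverse of an isomorphism to the cycle with chords \<open>D\<close>, extended periodically from \<open>{1..n}\<close> to the
  integers.
\<close>

definition enumerates :: "'a pair_pre_digraph \<Rightarrow> nat \<Rightarrow> (nat \<times> nat) set \<Rightarrow> (int \<Rightarrow> 'a) \<Rightarrow> bool" where
  "enumerates G n D c \<longleftrightarrow> cyclic_enum (parcs G) n c \<and> pverts G = range c \<and>
     (\<forall>i\<in>{1..n}. \<forall>j\<in>{1..n}. (c (int i), c (int j)) \<in> parcs G \<longleftrightarrow> (i, j) \<in> parcs (cycle_plus n D))"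

lemma parcs_cycle_plus_iff:
  "(i, j) \<in> parcs (cycle_plus n D) \<longleftrightarrow>
     1 \<le> i \<and> i < n \<and> j = i + 1 \<or> i = n \<and> j = 1 \<or> 1 \<le> j \<and> j < n \<and> i = j + 1 \<or> j = n \<and> i = 1 \<or>
     (i, j) \<in> D \<or> (j, i) \<in> D"
  unfolding cycle_plus_def cycle_edges_def by auto

lemma enumerates_bij:
  assumes "cyclic_enum E n c" "n > 0"
  shows "bij_betw (\<lambda>i. c (int i)) {1..n} (range c)"
proof -
  have "inj_on (\<lambda>i. c (int i)) {1..n}"
  proof (rule inj_onI)
    fix i j assume "i \<in> {1..n}" "j \<in> {1..n}" "c (int i) = c (int j)"
    then show "i = j" using cyclic_enum_inj[OF assms(1), of "int i" "int j"] by auto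
  qed
  moreover have "{1..<1 + int n} = int ` {1..n}"
    by (auto simp: image_int_atLeastAtMost)
  then have "range c = (\<lambda>i. c (int i)) ` {1..n}"
    using cyclic_enum_range[OF assms, of 1] by (simp add: image_image)
  ultimately show ?thesis by (simp add: bij_betw_def)
qed

lemma digraph_iso_cycle_plus_iff:
  assumes G: "pair_graph G" and n: "n > 0" and D: "D \<subseteq> {1..n} \<times> {1..n}"
  shows "digraph_iso (with_proj G) (with_proj (cycle_plus n D)) \<longleftrightarrow> (\<exists>c. enumerates G n D c)"
proof
  interpret pair_graph G by fact
  assume "digraph_iso (with_proj G) (with_proj (cycle_plus n D))"
  then obtain h where h: "digraph_isomorphism h" "with_proj (cycle_plus n D) = app_iso h (with_proj G)"
    unfolding digraph_iso_def by blast
  define \<phi> where "\<phi> = iso_verts h"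
  have "verts (with_proj (cycle_plus n D)) = \<phi> ` pverts G" using h(2) by (simp add: \<phi>_def)
  then have img: "\<phi> ` pverts G = {1..n}" by (simp add: cycle_plus_def)
  have inj: "inj_on \<phi> (pverts G)" using digraph_isomorphism_inj_on_verts[OF h(1)] by (simp add: \<phi>_def)
  have "arcs_ends (with_proj (cycle_plus n D)) = (\<lambda>(u, v). (\<phi> u, \<phi> v)) ` parcs G"
    unfolding h(2) arcs_ends_app_iso_eq[OF h(1)] by (simp add: \<phi>_def)
  then have arcs: "parcs (cycle_plus n D) = (\<lambda>(u, v). (\<phi> u, \<phi> v)) ` parcs G" by simp
  define \<psi> where "\<psi> = the_inv_into (pverts G) \<phi>"
  have \<psi>: "bij_betw \<psi> {1..n} (pverts G)"
    unfolding \<psi>_def by (rule bij_betw_the_inv_into) (simp add: bij_betw_def inj img)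
  have \<phi>\<psi>: "\<phi> (\<psi> i) = i" if "i \<in> {1..n}" for i
    unfolding \<psi>_def by (rule f_the_inv_into_f[OF inj]) (use img that in auto)
  have \<psi>\<phi>: "\<psi> (\<phi> v) = v" if "v \<in> pverts G" for v
    unfolding \<psi>_def by (rule the_inv_into_f_f[OF inj that])
  have edge: "(\<psi> i, \<psi> j) \<in> parcs G \<longleftrightarrow> (i, j) \<in> parcs (cycle_plus n D)"
    if "i \<in> {1..n}" "j \<in> {1..n}" for i j
  proof
    assume "(\<psi> i, \<psi> j) \<in> parcs G"
    then show "(i, j) \<in> parcs (cycle_plus n D)"
      unfolding arcs using \<phi>\<psi>[OF that(1)] \<phi>\<psi>[OF that(2)] 
      by (intro image_eqI[of _ _ "(\<psi> i, \<psi> j)"]) (simp only: prod.case, assumption)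
  next
    assume "(i, j) \<in> parcs (cycle_plus n D)"
    then obtain u v where "(u, v) \<in> parcs G" "i = \<phi> u" "j = \<phi> v" unfolding arcs by auto
    then show "(\<psi> i, \<psi> j) \<in> parcs G" using \<psi>\<phi> in_arcsD1 in_arcsD2 by metis
  qed
  define d where "d t = \<psi> (t + 1)" for t
  have "inj_on d {..<n}"
  proof (rule inj_onI)
    fix s t assume "s \<in> {..<n}" "t \<in> {..<n}" "d s = d t"
    then show "s = t"
      using inj_onD[OF bij_betw_imp_inj_on[OF \<psi>], of "s + 1" "t + 1"] by (simp add: d_def)
  qed
  moreover have "(d t, d (t + 1)) \<in> parcs G" if "t + 1 < n" for t
    using edge[of "t + 1" "t + 2"] that by (simp add: d_def parcs_cycle_plus_iff)
  moreover have "(d (n - 1), d 0) \<in> parcs G"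
    using edge[of n 1] n by (simp add: d_def parcs_cycle_plus_iff)
  ultimately have "cyclic_enum (parcs G) n (\<lambda>i. d (nat (i mod int n)))"
    using n by (intro cyclic_enum_of_list)
  \<comment> \<open>The labels start at 1 and the list \<open>d\<close> at 0, hence the rotation by one step.\<close>
  from cyclic_enum_rotate[OF this, of "- 1"]
  have c: "cyclic_enum (parcs G) n (\<lambda>i. d (nat ((i - 1) mod int n)))" by simp
  have c_\<psi>: "d (nat ((int i - 1) mod int n)) = \<psi> i" if "i \<in> {1..n}" for i
    using that by (simp add: d_def nat_diff_distrib)
  have "range (\<lambda>i. d (nat ((i - 1) mod int n))) = \<psi> ` {1..n}"
    unfolding bij_betw_imp_surj_on[OF enumerates_bij[OF c n], symmetric]
    by (rule image_cong[OF refl c_\<psi>])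
  then show "\<exists>c. enumerates G n D c"
    unfolding enumerates_def using c c_\<psi> edge \<psi> by (intro exI[of _ "\<lambda>i. d (nat ((i - 1) mod int n))"]) (auto simp: bij_betw_def)
next
  interpret pair_graph G by fact
  assume "\<exists>c. enumerates G n D c"
  then obtain c where c: "cyclic_enum (parcs G) n c" "pverts G = range c"
    and edge: "\<And>i j. i \<in> {1..n} \<Longrightarrow> j \<in> {1..n} \<Longrightarrow>
       (c (int i), c (int j)) \<in> parcs G \<longleftrightarrow> (i, j) \<in> parcs (cycle_plus n D)"
    unfolding enumerates_def by blast
  define \<phi> where "\<phi> = the_inv_into {1..n} (\<lambda>i. c (int i))"
  note bij = enumerates_bij[OF c(1) n]
  have \<phi>: "bij_betw \<phi> (pverts G) {1..n}"
    unfolding \<phi>_def c(2) by (rule bij_betw_the_inv_into[OF bij])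
  have c\<phi>: "c (int (\<phi> v)) = v" if "v \<in> pverts G" for v
    using f_the_inv_into_f_bij_betw[OF bij] that unfolding \<phi>_def c(2) by blast
  have \<phi>c: "\<phi> (c (int i)) = i" if "i \<in> {1..n}" for i
    unfolding \<phi>_def using bij_betw_imp_inj_on[OF bij] that by (rule the_inv_into_f_f)
  have \<phi>_in: "\<phi> v \<in> {1..n}" if "v \<in> pverts G" for v using bij_betwE[OF \<phi>] that by blast
  define h where "h = \<lparr>iso_verts = \<phi>, iso_arcs = map_prod \<phi> \<phi>, iso_head = snd, iso_tail = fst\<rparr>"
  have inj: "inj_on \<phi> (pverts G)" using \<phi> by (simp add: bij_betw_def)
  have "inj_on (map_prod \<phi> \<phi>) (parcs G)"
    by (rule inj_on_subset[OF map_prod_inj_on[OF inj inj]]) (auto dest: in_arcsD1 in_arcsD2)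
  then have iso: "digraph_isomorphism h"
    unfolding digraph_isomorphism_def h_def using inj wf_digraph by auto
  have "map_prod \<phi> \<phi> ` parcs G = parcs (cycle_plus n D)"
  proof (intro equalityI subsetI)
    fix e assume "e \<in> map_prod \<phi> \<phi> ` parcs G"
    then obtain u v where "e = (\<phi> u, \<phi> v)" "(u, v) \<in> parcs G" by auto
    then show "e \<in> parcs (cycle_plus n D)"
      using edge[of "\<phi> u" "\<phi> v"] \<phi>_in c\<phi> in_arcsD1 in_arcsD2 by metis
  next
    fix e assume e: "e \<in> parcs (cycle_plus n D)"
    obtain i j where ij: "e = (i, j)" by fastforce
    then have "i \<in> {1..n}" "j \<in> {1..n}" using e D n by (auto simp: parcs_cycle_plus_iff)
    then have "(c (int i), c (int j)) \<in> parcs G" "e = map_prod \<phi> \<phi> (c (int i), c (int j))"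
      using edge e ij \<phi>c by auto
    then show "e \<in> map_prod \<phi> \<phi> ` parcs G" by blast
  qed
  moreover have "\<phi> ` pverts G = {1..n}" using \<phi> by (simp add: bij_betw_def)
  ultimately have "with_proj (cycle_plus n D) = app_iso h (with_proj G)"
    unfolding app_iso_def h_def with_proj_def by (simp add: cycle_plus_def)
  then show "digraph_iso (with_proj G) (with_proj (cycle_plus n D))"
    unfolding digraph_iso_def using iso by blast
qed

section \<open>The graphs of the theorem are critical\<close>

text \<open>
  If all vertices but three are pairwise non-adjacent, they can share colour 1, and the
  remaining three colours are used at most once, so that no further distances matter.
\<close>

lemma independent_set_colouring:
  assumes V: "V = S \<union> {x, y, z}" and "S \<inter> {x, y, z} = {}" "x \<notin> {y, z}"
    and indep: "\<And>u v. u \<in> S \<Longrightarrow> v \<in> S \<Longrightarrow> (u, v) \<notin> E"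
  shows "\<exists>f. packing_colouring E V 4 f \<and> (\<forall>v\<in>V. f v = 4 \<longrightarrow> v = x)"
proof -
  define f :: "'a \<Rightarrow> nat" where "f v = (if v = x then 4 else if v = y then 2 else if v = z then 3 else 1)" for v
  have "(u, v) \<notin> E ^^ j" if uv: "u \<in> V" "v \<in> V" "u \<noteq> v" "f u = f v" "j \<le> f u" for u v j
  proof -
    have one: "f w = 1" if "w \<in> S" for w using assms(2) that by (auto simp: f_def)
    have "1 < f w" if "w \<in> {x, y, z}" for w using that by (auto simp: f_def)
    moreover have "w = w'" if "w \<in> {x, y, z}" "w' \<in> {x, y, z}" "f w = f w'" for w w'
      using that assms(3) unfolding f_def by (elim insertE emptyE) (simp_all split: if_splits)
    ultimately have "u \<in> S" "v \<in> S" "f u = 1"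
      using one[of u] one[of v] uv V by (metis Un_iff less_irrefl)+
    then show ?thesis using indep uv by (cases j) auto
  qed
  then have "packing_colouring E V 4 f" unfolding packing_colouring_def by (auto simp: f_def)
  then show ?thesis by (intro exI[of _ f]) (auto simp: f_def)
qed

text \<open>
  Of two disjoint non-adjacent pairs, at least one avoids \<open>x\<close>; its members get colour 1.
\<close>

lemma five_vertices_colouring:
  assumes V: "V = {a, b, c, d, e}" "distinct [a, b, c, d, e]" and "sym E" "irrefl E"
    and no: "(a, b) \<notin> E" "(c, d) \<notin> E" and x: "x \<in> V"
  shows "\<exists>f. packing_colouring E V 4 f \<and> (\<forall>v\<in>V. f v = 4 \<longrightarrow> v = x)"
proof -
  have ab: "(u, v) \<notin> E" if "u \<in> {a, b}" "v \<in> {a, b}" for u v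
    using that no assms(3,4) by (auto simp: irrefl_def dest: symD)
  have cd: "(u, v) \<notin> E" if "u \<in> {c, d}" "v \<in> {c, d}" for u v
    using that no assms(3,4) by (auto simp: irrefl_def dest: symD)
  consider "x = a" | "x = b" | "x = c" | "x = d" | "x = e" using x V by blast
  then show ?thesis
  proof cases
    case 1 show ?thesis by (rule independent_set_colouring[of V "{c, d}" x b e]) (use 1 V cd in auto)
  next
    case 2 show ?thesis by (rule independent_set_colouring[of V "{c, d}" x a e]) (use 2 V cd in auto)
  next
    case 3 show ?thesis by (rule independent_set_colouring[of V "{a, b}" x d e]) (use 3 V ab in auto)
  next
    case 4 show ?thesis by (rule independent_set_colouring[of V "{a, b}" x c e]) (use 4 V ab in auto)
  next
    case 5 show ?thesis by (rule independent_set_colouring[of V "{a, b}" x c d]) (use 5 V ab in auto)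
  qed
qed

text \<open>
  The part that does not contain \<open>x\<close> gets colour 1.
\<close>

lemma bipartite_3_3_colouring:
  assumes V: "V = A \<union> B" "A \<inter> B = {}" and "card A = 3" "card B = 3"
    and A: "\<And>u v. u \<in> A \<Longrightarrow> v \<in> A \<Longrightarrow> (u, v) \<notin> E"
    and B: "\<And>u v. u \<in> B \<Longrightarrow> v \<in> B \<Longrightarrow> (u, v) \<notin> E"
    and x: "x \<in> V"
  shows "\<exists>f. packing_colouring E V 4 f \<and> (\<forall>v\<in>V. f v = 4 \<longrightarrow> v = x)"
proof -
  have split: "\<exists>y z. X = {x, y, z} \<and> x \<notin> {y, z}" if "card X = 3" "x \<in> X" for X
  proof -
    have "card (X - {x}) = 2" using that by simp
    then obtain y z where yz: "X - {x} = {y, z}" by (meson card_2_iff)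
    then have "X = {x, y, z}" "x \<notin> {y, z}" using that(2) by blast+
    then show ?thesis by blast
  qed
  show ?thesis
  proof (cases "x \<in> A")
    case True
    then obtain y z where "A = {x, y, z}" "x \<notin> {y, z}" using split assms(3) by blast
    then show ?thesis using V B by (intro independent_set_colouring[of V B x y z]) auto
  next
    case False
    then obtain y z where "B = {x, y, z}" "x \<notin> {y, z}" using split[of B] assms(4) x V by blast
    then show ?thesis using V A by (intro independent_set_colouring[of V A x y z]) auto
  qed
qed

lemma relpow_cycle:
  assumes "\<And>u v. (u, v) \<in> E \<Longrightarrow> \<exists>i. u = c i \<and> v = c (i + 1) \<or> v = c i \<and> u = c (i + 1)"
    and c: "cyclic_enum E n c" and "(c i, v) \<in> E ^^ j"
  shows "\<exists>d. \<bar>d\<bar> \<le> int j \<and> v = c (i + d)"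
  using assms(3)
proof (induction j arbitrary: v)
  case 0 then show ?case by (intro exI[of _ 0]) simp
next
  case (Suc j)
  then obtain w where w: "(c i, w) \<in> E ^^ j" "(w, v) \<in> E" by auto
  with Suc.IH obtain d where w: "\<bar>d\<bar> \<le> int j" "w = c (i + d)" "(w, v) \<in> E" by blast
  from assms(1)[OF w(3)] consider k where "w = c k" "v = c (k + 1)" | k where "v = c k" "w = c (k + 1)"
    by blast
  then show ?case
  proof cases
    case 1
    then have "c (i + (d + 1)) = v" using cyclic_enum_shift[OF c, of "i + d" k 1] w by (simp add: add.assoc)
    then show ?thesis using w(1) by (intro exI[of _ "d + 1"]) auto
  next
    case 2
    then have "c (i + (d - 1)) = v" using cyclic_enum_shift[OF c, of "i + d" "k + 1" "- 1"] w by (simp add: add_diff_eq)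
    then show ?thesis using w(1) by (intro exI[of _ "d - 1"]) auto
  qed
qed

text \<open>
  Starting after \<open>c 0\<close>, the colours are \<open>1, 2, 1, 3\<close> repeated. Inside a period this is the usual colouring
  of a path. Across \<open>c 0\<close> it causes no conflict because the first occurrences of the colours 1, 2 and 3
  are at the positions 1, 2 and 4, so a step past 0 to the last position \<open>n - 1\<close> is longer than the
  colour allows.
\<close>

lemma cycle_colouring:
  assumes edges: "\<And>u v. (u, v) \<in> E \<Longrightarrow> \<exists>i. u = c i \<and> v = c (i + 1) \<or> v = c i \<and> u = c (i + 1)"
    and c: "cyclic_enum E n c" and n: "n \<ge> 5" and V: "V = range c"
  shows "\<exists>f. packing_colouring E V 4 f \<and> (\<forall>v\<in>V. f v = 4 \<longrightarrow> v = c 0)"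
proof -
  define col :: "int \<Rightarrow> nat" where
    "col i = (if i = 0 then 4 else if odd i then 1 else if i mod 4 = 2 then 2 else 3)" for i
  define idx where "idx v = (SOME i. v = c i) mod int n" for v
  have idx: "c (idx v) = v \<and> 0 \<le> idx v \<and> idx v < int n" if "v \<in> V" for v
  proof -
    have "v = c (SOME i. v = c i)" by (rule someI_ex) (use that V in blast)
    then show ?thesis using cyclic_enum_mod[OF c] n unfolding idx_def by auto
  qed
  have no_clash: False
    if H: "0 \<le> i" "i < int n" "0 \<le> j" "j < int n" "i \<noteq> j" "col i = col j" "\<bar>d\<bar> \<le> int (col i)"
      "(i + d) mod int n = j mod int n" for i j d
  proof -
    have i0: "i \<noteq> 0" "j \<noteq> 0" using H(5,6) by (auto simp: col_def split: if_splits)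
    then have d3: "\<bar>d\<bar> \<le> 3" using H(7) by (auto simp: col_def split: if_splits)
    obtain q where q: "i + d - j = int n * q" using H(8) unfolding mod_eq_dvd_iff by blast
    \<comment> \<open>A walk of length at most 3 goes around the cycle less than twice, so it wraps at most once.\<close>
    have "\<bar>int n * q\<bar> < int n * 2" using q H(1-4) i0 d3 n by linarith
    then have "int n * \<bar>q\<bar> < int n * 2" by (simp add: abs_mult)
    then have "q = - 1 \<or> q = 0 \<or> q = 1" using n by auto
    then have cases: "i + d - j = - int n \<or> i + d = j \<or> i + d - j = int n" using q by auto
    have i: "0 < i" "i < int n" "0 < j" "j < int n" using H(1-4) i0 by auto
    have col_cases: "col k = 1 \<and> odd k \<or> col k = 2 \<and> k mod 4 = 2 \<or> col k = 3 \<and> k mod 4 = 0"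
      if "k \<noteq> 0" for k
    proof -
      have "even k \<Longrightarrow> k mod 4 \<noteq> 2 \<Longrightarrow> k mod 4 = 0" by presburger
      then show ?thesis using that unfolding col_def by argo
    qed
    have "odd i \<and> odd j \<and> \<bar>d\<bar> \<le> 1 \<or> i mod 4 = 2 \<and> j mod 4 = 2 \<and> \<bar>d\<bar> \<le> 2
      \<or> i mod 4 = 0 \<and> j mod 4 = 0 \<and> \<bar>d\<bar> \<le> 3"
      using col_cases[OF i0(1)] col_cases[OF i0(2)] H(6,7) by (elim disjE conjE) simp_all
    then consider "odd i" "odd j" "\<bar>d\<bar> \<le> 1" | "i mod 4 = 2" "j mod 4 = 2" "\<bar>d\<bar> \<le> 2"
      | "i mod 4 = 0" "j mod 4 = 0" "\<bar>d\<bar> \<le> 3" by blast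
    then show False
    proof cases
      case 1
      then have "i + d = j" using cases i by linarith
      then show ?thesis using 1 H(5) by presburger
    next
      case 2
      have "2 \<le> i" "2 \<le> j" using 2(1,2) i(1,3) by presburger+
      then have "i + d = j" using cases i 2(3) by linarith
      then show ?thesis using 2 H(5) by presburger
    next
      case 3
      have "4 \<le> i" "4 \<le> j" using 3(1,2) i(1,3) by presburger+
      then have "i + d = j" using cases i 3(3) by linarith
      then show ?thesis using 3 H(5) by presburger
    qed
  qed
  have "packing_colouring E V 4 (col \<circ> idx)"
    unfolding packing_colouring_def
  proof (intro conjI ballI allI impI)
    fix u v j assume uv: "u \<in> V" "v \<in> V" "u \<noteq> v \<and> (col \<circ> idx) u = (col \<circ> idx) v" "j \<le> (col \<circ> idx) u"
    show "(u, v) \<notin> E ^^ j"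
    proof
      assume "(u, v) \<in> E ^^ j"
      then obtain d where d: "\<bar>d\<bar> \<le> int j" "v = c (idx u + d)"
        using relpow_cycle[OF edges c, of "idx u" v j] idx[OF uv(1)] by auto
      then have "(idx u + d) mod int n = idx v mod int n"
        using idx[OF uv(2)] cyclic_enum_eq_iff[OF c] by metis
      moreover have "idx u \<noteq> idx v" using idx uv by metis
      ultimately show False
        using no_clash[of "idx u" "idx v" d] idx[OF uv(1)] idx[OF uv(2)] uv d by simp
    qed
  qed (auto simp: col_def)
  moreover have "v = c 0" if "v \<in> V" "(col \<circ> idx) v = 4" for v
    using that idx[OF that(1)] by (auto simp: col_def split: if_splits)
  ultimately show ?thesis by blast
qed

lemma enumerates_edge_iff:
  "enumerates G n D c \<Longrightarrow> i \<in> {1..n} \<Longrightarrow> j \<in> {1..n} \<Longrightarrow>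
     (c (int i), c (int j)) \<in> parcs G \<longleftrightarrow> (i, j) \<in> parcs (cycle_plus n D)"
  unfolding enumerates_def by blast

lemma enumerates_vertices:
  assumes "enumerates G n D c" "n > 0"
  shows "pverts G = (\<lambda>i. c (int i)) ` {1..n}"
  using enumerates_bij[of "parcs G" n c] assms unfolding enumerates_def bij_betw_def by auto

lemma cycle_critical:
  assumes G: "pair_graph G" and c: "enumerates G n {} c" and n: "n \<ge> 5" "n mod 4 \<noteq> 0"
  shows "packing_critical 4 (with_proj G)"
proof (rule colourings_imp_critical[OF G])
  interpret pair_graph G by fact
  have cyc: "cyclic_enum (parcs G) n c" and V: "pverts G = range c"
    using c unfolding enumerates_def by auto
  show "pverts G \<noteq> {}" using V by simp
  show "\<not> packing_colouring (parcs G) (pverts G) 3 f" for f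
    using cyclic_not_3_colourable[OF cyc n] V by simp
  have edges: "\<exists>i. u = c i \<and> v = c (i + 1) \<or> v = c i \<and> u = c (i + 1)" if uv: "(u, v) \<in> parcs G" for u v
  proof -
    have "pverts G = (\<lambda>i. c (int i)) ` {1..n}" using enumerates_vertices[OF c] n by simp
    then obtain i j where ij: "u = c (int i)" "v = c (int j)" "i \<in> {1..n}" "j \<in> {1..n}"
      using in_arcsD1[OF uv] in_arcsD2[OF uv] by blast
    then have "(i, j) \<in> parcs (cycle_plus n {})" using that c unfolding enumerates_def by blast
    moreover have "c (int n + 1) = c 1" using cyclic_enum_period[OF cyc, of 1] by (simp add: add.commute)
    ultimately show ?thesis unfolding parcs_cycle_plus_iff ij by (auto simp: add.commute)
  qed
  fix x assume "x \<in> pverts G"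
  then obtain s where s: "x = c s" using V by blast
  have "\<exists>i. u = c (i + s) \<and> v = c (i + 1 + s) \<or> v = c (i + s) \<and> u = c (i + 1 + s)"
    if "(u, v) \<in> parcs G" for u v
    using edges[OF that] by (metis diff_add_cancel add.assoc add.commute)
  from cycle_colouring[OF this cyclic_enum_rotate[OF cyc]]
  show "\<exists>f. packing_colouring (parcs G) (pverts G) 4 f \<and> (\<forall>v\<in>pverts G. f v = 4 \<longrightarrow> v = x)"
    using n V s range_rotate[of c s] by auto
qed

text \<open>
  Both the cycle edges and the antipodal chords join positions of different parity, so the even and the odd positions are the two parts.
\<close>

lemma six_cycle_with_antipodal_chords_critical:
  assumes G: "pair_graph G" and c: "enumerates G 6 D c" and D: "D \<subseteq> {(1,4), (2,5), (3,6)}"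
  shows "packing_critical 4 (with_proj G)"
proof (rule colourings_imp_critical[OF G])
  interpret pair_graph G by fact
  have cyc: "cyclic_enum (parcs G) 6 c" and V: "pverts G = range c"
    using c unfolding enumerates_def by auto
  show "pverts G \<noteq> {}" using V by simp
  show "\<not> packing_colouring (parcs G) (pverts G) 3 f" for f
    using cyclic_not_3_colourable[OF cyc] V by simp
  let ?c = "\<lambda>i::nat. c (int i)"
  have inj: "inj_on ?c {1..6}" using enumerates_bij[OF cyc] by (simp add: bij_betw_def)
  have part: "{1..6::nat} = {1, 3, 5} \<union> {2, 4, 6}" by auto
  fix x assume x: "x \<in> pverts G"
  show "\<exists>f. packing_colouring (parcs G) (pverts G) 4 f \<and> (\<forall>v\<in>pverts G. f v = 4 \<longrightarrow> v = x)"
  proof (rule bipartite_3_3_colouring[OF _ _ _ _ _ _ x])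
    show "pverts G = ?c ` {1, 3, 5} \<union> ?c ` {2, 4, 6}"
      using enumerates_vertices[OF c] unfolding part image_Un by simp
    show "?c ` {1, 3, 5} \<inter> ?c ` {2, 4, 6} = {}"
      using inj_on_image_Int[OF inj, of "{1, 3, 5}" "{2, 4, 6}"] by auto
    show "card (?c ` {1, 3, 5}) = 3" "card (?c ` {2, 4, 6}) = 3"
      using card_image[OF inj_on_subset[OF inj], of "{1, 3, 5}"]
        card_image[OF inj_on_subset[OF inj], of "{2, 4, 6}"] by simp_all
    show "(u, v) \<notin> parcs G" if uv: "u \<in> ?c ` {1, 3, 5}" "v \<in> ?c ` {1, 3, 5}" for u v
    proof -
      obtain i j where ij: "i \<in> {1, 3, 5}" "j \<in> {1, 3, 5}" "u = ?c i" "v = ?c j" using uv by blast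
      then have "(i, j) \<notin> parcs (cycle_plus 6 D)" using D by (auto simp: parcs_cycle_plus_iff)
      moreover have "i \<in> {1..6}" "j \<in> {1..6}" using ij by auto
      ultimately show ?thesis using enumerates_edge_iff[OF c] ij(3,4) by blast
    qed
    show "(u, v) \<notin> parcs G" if uv: "u \<in> ?c ` {2, 4, 6}" "v \<in> ?c ` {2, 4, 6}" for u v
    proof -
      obtain i j where ij: "i \<in> {2, 4, 6}" "j \<in> {2, 4, 6}" "u = ?c i" "v = ?c j" using uv by blast
      then have "(i, j) \<notin> parcs (cycle_plus 6 D)" using D by (auto simp: parcs_cycle_plus_iff)
      moreover have "i \<in> {1..6}" "j \<in> {1..6}" using ij by auto
      ultimately show ?thesis using enumerates_edge_iff[OF c] ij(3,4) by blast
    qed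
  qed
qed

text \<open>
  Every set \<open>D\<close> in the list leaves two disjoint chords missing: 14 and 25, or 13 and 24 if 14 is present.
\<close>

lemma five_cycle_with_chords_critical:
  assumes G: "pair_graph G" and c: "enumerates G 5 D c"
    and D: "D \<in> {{}, {(3,5)}, {(3,5), (1,4)}, {(3,5), (1,3)}, {(3,5), (1,3), (2,4)}}"
  shows "packing_critical 4 (with_proj G)"
proof (rule colourings_imp_critical[OF G])
  interpret pair_graph G by fact
  have cyc: "cyclic_enum (parcs G) 5 c" and V: "pverts G = range c"
    using c unfolding enumerates_def by auto
  show "pverts G \<noteq> {}" using V by simp
  show "\<not> packing_colouring (parcs G) (pverts G) 3 f" for f
    using cyclic_not_3_colourable[OF cyc] V by simp
  let ?c = "\<lambda>i::nat. c (int i)"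
  have inj: "inj_on ?c {1..5}" using enumerates_bij[OF cyc] by (simp add: bij_betw_def)
  have part: "{1..5::nat} = {1, 2, 3, 4, 5}" by auto
  have V5: "pverts G = {?c 1, ?c 2, ?c 3, ?c 4, ?c 5}" using enumerates_vertices[OF c] unfolding part by simp
  have dist: "distinct [?c 1, ?c 2, ?c 3, ?c 4, ?c 5]"
    using inj unfolding part by (auto simp: inj_on_def)
  have sym: "sym (parcs G)" using arcs_symmetric by (auto intro: symI)
  have irr: "irrefl (parcs G)" using no_loops' by (auto simp: irrefl_def)
  have non_edge: "(i, j) \<notin> parcs (cycle_plus 5 D) \<Longrightarrow> i \<in> {1..5} \<Longrightarrow> j \<in> {1..5} \<Longrightarrow> (?c i, ?c j) \<notin> parcs G"
    for i j using c unfolding enumerates_def by blast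
  fix x assume x: "x \<in> pverts G"
  show "\<exists>f. packing_colouring (parcs G) (pverts G) 4 f \<and> (\<forall>v\<in>pverts G. f v = 4 \<longrightarrow> v = x)"
  proof (cases "D = {(3,5), (1,4)}")
    case True
    have "(?c 1, ?c 3) \<notin> parcs G" "(?c 2, ?c 4) \<notin> parcs G"
      by (rule non_edge; simp add: parcs_cycle_plus_iff True)+
    then show ?thesis using V5 dist
      by (intro five_vertices_colouring[OF _ _ sym irr _ _ x, of "?c 1" "?c 3" "?c 2" "?c 4" "?c 5"]) auto
  next
    case False
    then have "(?c 1, ?c 4) \<notin> parcs G" "(?c 2, ?c 5) \<notin> parcs G"
      using D by (intro non_edge; auto simp: parcs_cycle_plus_iff)+
    then show ?thesis using V5 dist
      by (intro five_vertices_colouring[OF _ _ sym irr _ _ x, of "?c 1" "?c 4" "?c 2" "?c 5" "?c 3"]) auto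
  qed
qed

section \<open>Critical graphs are these graphs\<close>

lemma (in pair_graph) sym_parcs: "sym (parcs G)"
  using arcs_symmetric by (auto intro: symI)

lemma critical_no_avoiding_cycle:
  assumes G: "pair_graph G" and crit: "packing_critical 4 (with_proj G)" and x: "x \<in> pverts G"
    and c: "cyclic_enum (Restr (parcs G) (pverts G - {x})) m c" and m: "m \<ge> 5" "m mod 4 \<noteq> 0"
  shows False
proof -
  obtain f where "packing_colouring (Restr (parcs G) (pverts G - {x})) (pverts G - {x}) 3 f"
    using critical_imp_deleted_colourable[OF G crit x] by blast
  moreover have "range c \<subseteq> pverts G - {x}" using cyclic_enum_edge[OF c] by blast
  ultimately show False using cyclic_not_3_colourable[OF c m] by blast
qed

lemma cyclic_enum_Restr:
  "cyclic_enum E n c \<Longrightarrow> range c \<subseteq> W \<Longrightarrow> cyclic_enum (Restr E W) n c"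
  unfolding cyclic_enum_def by blast

lemma critical_imp_spanning:
  assumes G: "pair_graph G" and crit: "packing_critical 4 (with_proj G)"
    and c: "cyclic_enum (parcs G) n c" and n: "n \<ge> 5" "n mod 4 \<noteq> 0"
  shows "pverts G = range c"
proof -
  interpret pair_graph G by fact
  have sub: "range c \<subseteq> pverts G" using in_arcsD1 cyclic_enum_edge[OF c] by blast
  have False if "x \<in> pverts G" "x \<notin> range c" for x
    using critical_no_avoiding_cycle[OF G crit that(1) cyclic_enum_Restr[OF c] n] sub that(2) by blast
  then show ?thesis using sub by blast
qed

lemma no_short_chord:
  assumes G: "pair_graph G" and crit: "packing_critical 4 (with_proj G)"
    and c: "cyclic_enum (parcs G) n c" and V: "pverts G = range c"
    and k: "2 \<le> k" "k < n" and len: "n - k + 1 \<ge> 5" "(n - k + 1) mod 4 \<noteq> 0"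
  shows "(c i, c (i + int k)) \<notin> parcs G"
proof
  assume "(c i, c (i + int k)) \<in> parcs G"
  from chord_shortcut[OF c this k] V obtain c' where
    "cyclic_enum (Restr (parcs G) (pverts G - {c (i + 1)})) (n - k + 1) c'" by metis
  from critical_no_avoiding_cycle[OF G crit _ this len] V show False by blast
qed

lemma chord_reverse:
  assumes "pair_graph G" and c: "cyclic_enum (parcs G) n c" and "k \<le> n"
    and "(c i, c (i + int k)) \<in> parcs G"
  shows "(c (i + int k), c (i + int k + int (n - k))) \<in> parcs G"
proof -
  interpret pair_graph G by fact
  have "i + int k + int (n - k) = i + int n" using assms(3) by simp
  then show ?thesis using arcs_symmetric[OF assms(4)] cyclic_enum_period[OF c, of i] by simp
qed

text \<open>
  The chord and its surroundings occupy the positions \<open>-2, -1, 0, 1\<close> and \<open>k - 1, k, k + 1, k + 2\<close> relative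
  to \<open>i\<close>, and a further position \<open>t\<close> is deleted. The bound \<open>k + 4 \<le> n\<close>, which says that the chord
  leaves room on its far side, is no restriction after exchanging its ends.
\<close>

lemma no_chord_half:
  assumes G: "pair_graph G" and crit: "packing_critical 4 (with_proj G)"
    and c: "cyclic_enum (parcs G) n c" and V: "pverts G = range c"
    and n: "n \<ge> 9" and k: "2 \<le> k" "k + 4 \<le> n"
  shows "(c i, c (i + int k)) \<notin> parcs G"
proof
  interpret pair_graph G by fact
  assume chord: "(c i, c (i + int k)) \<in> parcs G"
  \<comment> \<open>Position 2 is free unless \<open>k \<le> 3\<close>; then position 6 lies beyond \<open>k + 2\<close> and before \<open>n - 2\<close>.\<close>
  define t :: int where "t = (if k \<ge> 4 then 2 else 6)"
  define W where "W = pverts G - {c (i + t)}"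
  obtain f where f: "packing_colouring (Restr (parcs G) W) W 3 f"
    using critical_imp_deleted_colourable[OF G crit, of "c (i + t)"] V unfolding W_def by blast
  have ne: "c (i + s) \<noteq> c (i + s')" if "s \<noteq> s'" "\<bar>s - s'\<bar> < int n" for s s'
    using cyclic_enum_inj[OF c, of "i + s" "i + s'"] that by auto
  have W: "c (i + s) \<in> W" if "s \<noteq> t" "\<bar>s - t\<bar> < int n" for s
    using ne[OF that] V unfolding W_def by auto
  let ?k = "int k"
  have in_W: "c i \<in> W" "c (i + ?k) \<in> W" "c (i + 1) \<in> W" "c (i - 1) \<in> W" "c (i - 2) \<in> W"
    "c (i + (?k - 1)) \<in> W" "c (i + (?k + 1)) \<in> W" "c (i + (?k + 2)) \<in> W"
    using W[of 0] W[of ?k] W[of 1] W[of "- 1"] W[of "- 2"] W[of "?k - 1"] W[of "?k + 1"] W[of "?k + 2"] n k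
    unfolding t_def by (simp_all split: if_splits)
  have fw: "(c j, c j') \<in> parcs G" if "j' = j + 1" for j j'
    using cyclic_enum_edge[OF c, of j] that by simp
  have bw: "(c j, c j') \<in> parcs G" if "j = j' + 1" for j j'
    using arcs_symmetric[OF fw[OF that]] .
  have dist4: "distinct [c (i + a), c (i + b), c (i + d), c (i + e)]"
    if "distinct [a, b, d, e]" "\<forall>s\<in>{a, b, d, e}. \<forall>s'\<in>{a, b, d, e}. \<bar>s - s'\<bar> < int n" for a b d e
    using that ne by simp
  have dist: "distinct [c (i + 0), c (i + ?k), c (i + 1), c (i + - 1)]"
    "distinct [c (i + 0), c (i + ?k), c (i + - 1), c (i + - 2)]"
    "distinct [c (i + ?k), c (i + 0), c (i + (?k - 1)), c (i + (?k + 1))]"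
    "distinct [c (i + ?k), c (i + 0), c (i + (?k + 1)), c (i + (?k + 2))]"
    by (rule dist4; use n k in auto)+
  have "sym (Restr (parcs G) W)" using sym_parcs by (auto simp: sym_def)
  from edge_with_two_branches_not_3_colourable[OF f this, of "c i" "c (i + ?k)" "c (i + 1)" "c (i - 1)"
      "c (i - 2)" "c (i + (?k - 1))" "c (i + (?k + 1))" "c (i + (?k + 2))"]
  show False
    using in_W dist chord fw bw by simp
qed

lemma critical_cycle_no_chord:
  assumes G: "pair_graph G" and crit: "packing_critical 4 (with_proj G)"
    and c: "cyclic_enum (parcs G) n c" and V: "pverts G = range c"
    and n: "n \<ge> 7" "n mod 4 \<noteq> 0" and k: "2 \<le> k" "k + 2 \<le> n"
  shows "(c i, c (i + int k)) \<notin> parcs G"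
proof -
  have half: "(c i, c (i + int k)) \<notin> parcs G" if k: "2 \<le> k" "k + 4 \<le> n" for i k
  proof (cases "n \<ge> 9")
    case True then show ?thesis using no_chord_half[OF G crit c V _ k] by blast
  next
    case False
    then have "n = 7" using n by presburger
    \<comment> \<open>Here the configuration fills all 7 vertices, but the chord cuts off a cycle of forbidden length.\<close>
    then have "n - k + 1 = 6 \<or> n - k + 1 = 5" using k by linarith
    then show ?thesis using no_short_chord[OF G crit c V k(1), of i] k by auto
  qed
  show ?thesis
  proof (cases "k + 4 \<le> n")
    case False
    then have "2 \<le> n - k" "n - k + 4 \<le> n" using k n by linarith+
    then show ?thesis using half chord_reverse[OF G c, of k i] k by fastforce
  qed (use half k in blast)
qed

lemma long_cycle_enumerates:
  assumes G: "pair_graph G" and crit: "packing_critical 4 (with_proj G)"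
    and c: "cyclic_enum (parcs G) n c" and V: "pverts G = range c"
    and n: "n \<ge> 7" "n mod 4 \<noteq> 0"
  shows "enumerates G n {} c"
  unfolding enumerates_def
proof (intro conjI ballI c V)
  interpret pair_graph G by fact
  fix i j assume ij: "i \<in> {1..n}" "j \<in> {1..n}"
  have wrap: "c (int n + 1) = c 1" using cyclic_enum_period[OF c, of 1] by (simp add: add.commute)
  show "(c (int i), c (int j)) \<in> parcs G \<longleftrightarrow> (i, j) \<in> parcs (cycle_plus n {})"
  proof
    assume e: "(c (int i), c (int j)) \<in> parcs G"
    have ne: "i \<noteq> j" using no_loops'[OF e] by blast
    have far: "\<not> (a < b \<and> b \<noteq> a + 1 \<and> \<not> (a = 1 \<and> b = n))"
      if "(c (int a), c (int b)) \<in> parcs G" "a \<in> {1..n}" "b \<in> {1..n}" for a b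
    proof
      assume ab: "a < b \<and> b \<noteq> a + 1 \<and> \<not> (a = 1 \<and> b = n)"
      then have "2 \<le> b - a" "b - a + 2 \<le> n" using that(2,3) by auto
      then show False
        using critical_cycle_no_chord[OF G crit c V n, of "b - a" "int a"] ab that(1) by simp
    qed
    show "(i, j) \<in> parcs (cycle_plus n {})"
      using far[OF e ij] far[OF arcs_symmetric[OF e] ij(2,1)] ne ij
      unfolding parcs_cycle_plus_iff by auto
  next
    assume "(i, j) \<in> parcs (cycle_plus n {})"
    then have "int j = int i + 1 \<or> int i = int j + 1 \<or> i = n \<and> j = 1 \<or> j = n \<and> i = 1"
      unfolding parcs_cycle_plus_iff by auto
    then show "(c (int i), c (int j)) \<in> parcs G"
      using cyclic_enum_edge[OF c, of "int i"] cyclic_enum_edge[OF c, of "int j"] wrap arcs_symmetric by auto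
  qed
qed

lemma six_cycle_enumerates:
  assumes G: "pair_graph G" and crit: "packing_critical 4 (with_proj G)"
    and c: "cyclic_enum (parcs G) 6 c" and V: "pverts G = range c"
  shows "\<exists>D \<subseteq> {(1,4), (2,5), (3,6)}. enumerates G 6 D c"
proof -
  interpret pair_graph G by fact
  define D :: "(nat \<times> nat) set" where
    "D = {(i, j). (i, j) \<in> {(1,4), (2,5), (3,6)} \<and> (c (int i), c (int j)) \<in> parcs G}"
  have D: "(i, j) \<in> D \<longleftrightarrow> (i = 1 \<and> j = 4 \<or> i = 2 \<and> j = 5 \<or> i = 3 \<and> j = 6) \<and> (c (int i), c (int j)) \<in> parcs G"
    for i j by (auto simp: D_def)
  have two: "(c i, c (i + 2)) \<notin> parcs G" for i
    using no_short_chord[OF G crit c V, of 2 i] by simp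
  have four: "(c i, c (i + 4)) \<notin> parcs G" for i
    using chord_reverse[OF G c, of 4 i] two[of "i + 4"] by auto
  have loop: "(v, v) \<notin> parcs G" for v using no_loops'[of v v] by blast
  have sym: "(u, v) \<in> parcs G \<longleftrightarrow> (v, u) \<in> parcs G" for u v using arcs_symmetric by blast
  note E = cyclic_enum_edge[OF c]
  have edges: "(c 1, c 2) \<in> parcs G" "(c 2, c 3) \<in> parcs G" "(c 3, c 4) \<in> parcs G" "(c 4, c 5) \<in> parcs G"
    "(c 5, c 6) \<in> parcs G" "(c 1, c 6) \<in> parcs G"
    using sym[of "c 6" "c 1"] E[of 1] E[of 2] E[of 3] E[of 4] E[of 5] E[of 6] cyclic_enum_period[OF c, of 1] by simp_all
  have non: "(c 1, c 3) \<notin> parcs G" "(c 2, c 4) \<notin> parcs G" "(c 3, c 5) \<notin> parcs G" "(c 4, c 6) \<notin> parcs G"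
    "(c 1, c 5) \<notin> parcs G" "(c 2, c 6) \<notin> parcs G"
    using two[of 1] two[of 2] two[of 3] two[of 4] four[of 1] four[of 2] by simp_all
  have I: "{1..6::nat} = {1, 2, 3, 4, 5, 6}" by auto
  note flip = sym[of "c 2" "c 1"] sym[of "c 3" "c 1"] sym[of "c 4" "c 1"] sym[of "c 5" "c 1"] sym[of "c 6" "c 1"]
      sym[of "c 3" "c 2"] sym[of "c 4" "c 2"] sym[of "c 5" "c 2"] sym[of "c 6" "c 2"]
      sym[of "c 4" "c 3"] sym[of "c 5" "c 3"] sym[of "c 6" "c 3"]
      sym[of "c 5" "c 4"] sym[of "c 6" "c 4"]
      sym[of "c 6" "c 5"]
  have "enumerates G 6 D c"
    unfolding enumerates_def I parcs_cycle_plus_iff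
    using c V by (simp add: edges flip non D loop)
  then show ?thesis by (intro exI[of _ D]) (auto simp: D_def)
qed

text \<open>
  The five chords of a 5-cycle are those that skip one vertex; the two that wrap around, from 4 to 6 and
  from 5 to 7, are the chords 14 and 25.
\<close>

lemma chords_imp_enumerates_5:
  assumes G: "pair_graph G" and c: "cyclic_enum (parcs G) 5 c" and V: "pverts G = range c"
    and D: "D \<subseteq> {(1,3), (2,4), (3,5), (1,4), (2,5)}"
    and "(1,3) \<in> D \<longleftrightarrow> (c 1, c (1 + 2)) \<in> parcs G" "(2,4) \<in> D \<longleftrightarrow> (c 2, c (2 + 2)) \<in> parcs G"
      "(3,5) \<in> D \<longleftrightarrow> (c 3, c (3 + 2)) \<in> parcs G" "(1,4) \<in> D \<longleftrightarrow> (c 4, c (4 + 2)) \<in> parcs G"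
      "(2,5) \<in> D \<longleftrightarrow> (c 5, c (5 + 2)) \<in> parcs G"
  shows "enumerates G 5 D c"
proof -
  interpret pair_graph G by fact
  have loop: "(v, v) \<notin> parcs G" for v using no_loops'[of v v] by blast
  have sym: "(u, v) \<in> parcs G \<longleftrightarrow> (v, u) \<in> parcs G" for u v using arcs_symmetric by blast
  have wrap: "c 6 = c 1" "c 7 = c 2" using cyclic_enum_period[OF c, of 1] cyclic_enum_period[OF c, of 2] by simp_all
  note E = cyclic_enum_edge[OF c]
  have edges: "(c 1, c 2) \<in> parcs G" "(c 2, c 3) \<in> parcs G" "(c 3, c 4) \<in> parcs G" "(c 4, c 5) \<in> parcs G"
    "(c 1, c 5) \<in> parcs G"
    using E[of 1] E[of 2] E[of 3] E[of 4] E[of 5] wrap sym[of "c 5" "c 1"] by simp_all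
  have chords: "(c 1, c 3) \<in> parcs G \<longleftrightarrow> (1,3) \<in> D" "(c 2, c 4) \<in> parcs G \<longleftrightarrow> (2,4) \<in> D"
    "(c 3, c 5) \<in> parcs G \<longleftrightarrow> (3,5) \<in> D" "(c 1, c 4) \<in> parcs G \<longleftrightarrow> (1,4) \<in> D" "(c 2, c 5) \<in> parcs G \<longleftrightarrow> (2,5) \<in> D"
    using assms(5-9) wrap sym[of "c 1" "c 4"] sym[of "c 2" "c 5"] by simp_all
  have not_D: "(3,1) \<notin> D" "(4,2) \<notin> D" "(5,3) \<notin> D" "(4,1) \<notin> D" "(5,2) \<notin> D"
    "(i, i) \<notin> D" for i
    by (rule notI, drule subsetD[OF D], fastforce)+
  have I: "{1..5::nat} = {1, 2, 3, 4, 5}" by auto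
  note flip = sym[of "c 2" "c 1"] sym[of "c 3" "c 1"] sym[of "c 4" "c 1"] sym[of "c 5" "c 1"]
      sym[of "c 3" "c 2"] sym[of "c 4" "c 2"] sym[of "c 5" "c 2"]
      sym[of "c 4" "c 3"] sym[of "c 5" "c 3"]
      sym[of "c 5" "c 4"]
  show ?thesis
    unfolding enumerates_def I parcs_cycle_plus_iff
    using c V by (simp add: edges flip chords not_D not_D[unfolded One_nat_def] loop)
qed

text \<open>
  Here \<open>P i\<close> says that the chord from \<open>i\<close> to \<open>i + 2\<close> is present, and the assumption that the four vertices
  other than \<open>i\<close> are not pairwise adjacent. It forces two consecutive values of \<open>P\<close> to be false, and
  rotations suffice to bring the other three into one of the five listed forms.
\<close>

lemma K4_free_pentagon:
  assumes "\<And>i. \<not> (P (i + 1) \<and> P (i + 2) \<and> P (i + 4))" and per: "\<And>i::int. P (i + 5) = P i"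
  obtains s and D :: "(nat \<times> nat) set" where "D \<in> {{}, {(3,5)}, {(3,5), (1,4)}, {(3,5), (1,3)}, {(3,5), (1,3), (2,4)}}"
    "(1,3) \<in> D \<longleftrightarrow> P (1 + s)" "(2,4) \<in> D \<longleftrightarrow> P (2 + s)" "(3,5) \<in> D \<longleftrightarrow> P (3 + s)"
    "(1,4) \<in> D \<longleftrightarrow> P (4 + s)" "(2,5) \<in> D \<longleftrightarrow> P (5 + s)"
proof -
  have wrap: "P 5 = P 0" "P 6 = P 1" "P 7 = P 2" "P 8 = P 3" "P 9 = P 4"
    using per[of 0] per[of 1] per[of 2] per[of 3] per[of 4] by simp_all
  have K4: "\<not> (P 1 \<and> P 2 \<and> P 4)" "\<not> (P 2 \<and> P 3 \<and> P 0)" "\<not> (P 3 \<and> P 4 \<and> P 1)"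
    "\<not> (P 4 \<and> P 0 \<and> P 2)" "\<not> (P 0 \<and> P 1 \<and> P 3)"
    using assms(1)[of 0] assms(1)[of 1] assms(1)[of 2] assms(1)[of 3] assms(1)[of 4] wrap by simp_all
  let ?chords = "\<lambda>s b13 b24 b35 b14 b25. P (1 + s) = b13 \<and> P (2 + s) = b24 \<and> P (3 + s) = b35 \<and>
    P (4 + s) = b14 \<and> P (5 + s) = b25"
  have "\<exists>s\<in>{0, 1, 2, 3, 4}. ?chords s False False False False False \<or> ?chords s False False True False False
      \<or> ?chords s False False True True False \<or> ?chords s True False True False False
      \<or> ?chords s True True True False False"
    using K4 by (cases "P 0"; cases "P 1"; cases "P 2"; cases "P 3"; cases "P 4") (simp_all add: wrap)
  then obtain s where "?chords s False False False False False \<or> ?chords s False False True False False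
      \<or> ?chords s False False True True False \<or> ?chords s True False True False False
      \<or> ?chords s True True True False False" by blast
  then show thesis
  proof (elim disjE)
    assume "?chords s False False False False False"
    then show thesis by (intro that[of "{}" s]) simp_all
  next
    assume "?chords s False False True False False"
    then show thesis by (intro that[of "{(3,5)}" s]) simp_all
  next
    assume "?chords s False False True True False"
    then show thesis by (intro that[of "{(3,5), (1,4)}" s]) simp_all
  next
    assume "?chords s True False True False False"
    then show thesis by (intro that[of "{(3,5), (1,3)}" s]) simp_all
  next
    assume "?chords s True True True False False"
    then show thesis by (intro that[of "{(3,5), (1,3), (2,4)}" s]) simp_all
  qed
qed

lemma five_cycle_enumerates:
  assumes G: "pair_graph G" and crit: "packing_critical 4 (with_proj G)"
    and c: "cyclic_enum (parcs G) 5 c" and V: "pverts G = range c"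
  shows "\<exists>D \<in> {{}, {(3,5)}, {(3,5), (1,4)}, {(3,5), (1,3)}, {(3,5), (1,3), (2,4)}}. \<exists>c. enumerates G 5 D c"
proof -
  interpret pair_graph G by fact
  define P where "P i \<longleftrightarrow> (c i, c (i + 2)) \<in> parcs G" for i
  have shift: "c (i + 5) = c i" for i using cyclic_enum_period[OF c, of i] by simp
  have period: "P (i + 5) = P i" for i
    using shift[of i] shift[of "i + 2"] by (simp add: P_def algebra_simps)
  have K4: "\<not> (P (i + 1) \<and> P (i + 2) \<and> P (i + 4))" for i
  proof
    assume P: "P (i + 1) \<and> P (i + 2) \<and> P (i + 4)"
    have "c i \<in> pverts G" using V by blast
    then obtain f where f: "packing_colouring (Restr (parcs G) (pverts G - {c i})) (pverts G - {c i}) 3 f"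
      using critical_imp_deleted_colourable[OF G crit] by blast
    have ne: "c (i + s) \<noteq> c (i + s')" if "s \<noteq> s'" "\<bar>s - s'\<bar> < 5" for s s'
      using cyclic_enum_inj[OF c, of "i + s" "i + s'"] that by auto
    have W: "c (i + s) \<in> pverts G - {c i}" if "s \<in> {1, 2, 3, 4}" for s
      using ne[of s 0] that V by auto
    have step: "(c (i + 1), c (i + 2)) \<in> parcs G" "(c (i + 2), c (i + 3)) \<in> parcs G" "(c (i + 3), c (i + 4)) \<in> parcs G"
      using cyclic_enum_edge[OF c, of "i + 1"] cyclic_enum_edge[OF c, of "i + 2"] cyclic_enum_edge[OF c, of "i + 3"]
      by (simp_all add: add.assoc)
    moreover have "(c (i + 1), c (i + 3)) \<in> parcs G" "(c (i + 2), c (i + 4)) \<in> parcs G"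
      using P by (simp_all add: P_def add.assoc)
    moreover have "c (i + 4 + 2) = c (i + 1)" using shift[of "i + 1"] by (simp add: add.assoc)
    then have "(c (i + 1), c (i + 4)) \<in> parcs G" using P arcs_symmetric by (simp add: P_def)
    moreover have "distinct [c (i + 1), c (i + 2), c (i + 3), c (i + 4)]" using ne by simp
    ultimately show False
      using K4_not_3_colourable[OF f, of "c (i + 1)" "c (i + 2)" "c (i + 3)" "c (i + 4)"] W by simp
  qed
  obtain s and D :: "(nat \<times> nat) set" where D: "D \<in> {{}, {(3,5)}, {(3,5), (1,4)}, {(3,5), (1,3)}, {(3,5), (1,3), (2,4)}}"
    and chords: "(1,3) \<in> D \<longleftrightarrow> P (1 + s)" "(2,4) \<in> D \<longleftrightarrow> P (2 + s)" "(3,5) \<in> D \<longleftrightarrow> P (3 + s)"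
    "(1,4) \<in> D \<longleftrightarrow> P (4 + s)" "(2,5) \<in> D \<longleftrightarrow> P (5 + s)"
    by (rule K4_free_pentagon[of P, OF K4 period])
  have "enumerates G 5 D (\<lambda>i. c (i + s))"
  proof (rule chords_imp_enumerates_5[OF G cyclic_enum_rotate[OF c]])
    show "pverts G = range (\<lambda>i. c (i + s))" using V range_rotate[of c s] by simp
    show "D \<subseteq> {(1,3), (2,4), (3,5), (1,4), (2,5)}" using D by auto
  qed (use chords in \<open>simp_all add: P_def algebra_simps\<close>)
  then show ?thesis using D by blast
qed

theorem theorem4p3:
  fixes G :: "'a pair_pre_digraph" and n :: nat
  assumes "pair_graph G" and "pverts G \<noteq> {}"
    and "n \<ge> 5" and "n mod 4 \<noteq> 0"
    and "has_cycle (with_proj G) n"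
  shows "packing_critical 4 (with_proj G) \<longleftrightarrow>
      (n = 5 \<and>
        (\<exists>D \<in> {{}, {(3,5)}, {(3,5), (1,4)}, {(3,5), (1,3)}, {(3,5), (1,3), (2,4)}}.
          digraph_iso (with_proj G) (with_proj (cycle_plus 5 D)))) \<or>
      (n = 6 \<and>
        (\<exists>D \<subseteq> {(1,4), (2,5), (3,6)}.
          digraph_iso (with_proj G) (with_proj (cycle_plus 6 D)))) \<or>
      (n \<ge> 7 \<and> digraph_iso (with_proj G) (with_proj (cycle_graph n)))"
proof -
  have iso5: "(\<exists>D \<in> \<D>. digraph_iso (with_proj G) (with_proj (cycle_plus 5 D))) \<longleftrightarrow> (\<exists>D \<in> \<D>. \<exists>c. enumerates G 5 D c)"
    if "\<And>D. D \<in> \<D> \<Longrightarrow> D \<subseteq> {1..5} \<times> {1..5}" for \<D>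
    using digraph_iso_cycle_plus_iff[OF assms(1), of 5] that by auto
  have iso6: "digraph_iso (with_proj G) (with_proj (cycle_plus 6 D)) \<longleftrightarrow> (\<exists>c. enumerates G 6 D c)"
    if "D \<subseteq> {(1,4), (2,5), (3,6)}" for D
    by (rule digraph_iso_cycle_plus_iff[OF assms(1)]) (use that in auto)
  have iso7: "digraph_iso (with_proj G) (with_proj (cycle_graph n)) \<longleftrightarrow> (\<exists>c. enumerates G n {} c)"
    using digraph_iso_cycle_plus_iff[OF assms(1), of n "{}"] assms(3) by simp
  obtain c where c: "cyclic_enum (parcs G) n c"
    using has_cycle_imp_cyclic_enum[OF assms(5)] by blast
  show ?thesis (is "_ \<longleftrightarrow> ?i \<or> ?ii \<or> ?iii")
  proof
    assume crit: "packing_critical 4 (with_proj G)"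
    note V = critical_imp_spanning[OF assms(1) crit c assms(3,4)]
    consider "n = 5" | "n = 6" | "n \<ge> 7" using assms(3) by linarith
    then show "?i \<or> ?ii \<or> ?iii"
    proof cases
      case 1
      then have ?i using five_cycle_enumerates[OF assms(1) crit, of c] c V by (subst iso5) auto
      then show ?thesis ..
    next
      case 2
      then have ?ii using six_cycle_enumerates[OF assms(1) crit, of c] c V iso6 by blast
      then show ?thesis by blast
    next
      case 3
      then have ?iii using long_cycle_enumerates[OF assms(1) crit c V _ assms(4)] iso7 by blast
      then show ?thesis by blast
    qed
  next
    assume "?i \<or> ?ii \<or> ?iii"
    then show "packing_critical 4 (with_proj G)"
    proof (elim disjE conjE)
      assume "n = 5" "\<exists>D \<in> {{}, {(3,5)}, {(3,5), (1,4)}, {(3,5), (1,3)}, {(3,5), (1,3), (2,4)}}.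
          digraph_iso (with_proj G) (with_proj (cycle_plus 5 D))"
      then show ?thesis using five_cycle_with_chords_critical[OF assms(1)] by (subst (asm) iso5) auto
    next
      assume "\<exists>D \<subseteq> {(1,4), (2,5), (3,6)}. digraph_iso (with_proj G) (with_proj (cycle_plus 6 D))"
      then show ?thesis using six_cycle_with_antipodal_chords_critical[OF assms(1)] iso6 by blast
    next
      assume "digraph_iso (with_proj G) (with_proj (cycle_graph n))"
      then show ?thesis using cycle_critical[OF assms(1) _ assms(3,4)] iso7 by blast
    qed
  qed
qed

end
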